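(* Let $A$, $B$, $\mathbb{Y}$, $A_1$, $B_1$, $C_1$ and $C_1-B_1$ be positive stable matrices in $\mathbb{C}^{r\times r}$ such that $B_1C_1=C_1B_1$. Then each of the following identities holds for every $z\in\mathbb{C}$ for which the last arguments of the two ${}_2F_1^{(A,B;\mathbb{Y})}$ functions occurring in it both have modulus less than $1$: $${}_2F_1^{(A,B;\mathbb{Y})}(A_1,B_1;C_1;z)=(1-z)^{-A_1}\;{}_2F_1^{(A,B;\mathbb{Y})}\!\left(A_1,C_1-B_1;C_1;\frac{z}{z-1}\right),$$ $${}_2F_1^{(A,B;\mathbb{Y})}\!\left(A_1,B_1;C_1;1-\frac1z\right)=z^{A_1}\;{}_2F_1^{(A,B;\mathbb{Y})}(A_1,C_1-B_1;C_1;1-z),$$ $${}_2F_1^{(A,B;\mathbb{Y})}\!\left(A_1,B_1;C_1;\frac{z}{1+z}\right)=(1+z)^{A_1}\;{}_2F_1^{(A,B;\mathbb{Y})}(A_1,C_1-B_1;C_1;-z).$$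
   Context: A matrix in $\mathbb{C}^{r\times r}$ is positive stable if all its eigenvalues have positive real part; $I$ is the identity matrix. For a matrix $M$ and a complex number $s\notin(-\infty,0]$, $s^M=\exp(M\log s)$ with the principal logarithm. The Pochhammer symbol is $(M)_0=I$, $(M)_n=M(M+I)\cdots(M+(n-1)I)$ for $n\ge1$. For positive stable $B$ and a square matrix $W$, ${}_1F_1(A;B;W)=\sum_{n\ge0}(A)_n\,[(B)_n]^{-1}\,\frac{W^n}{n!}$. For commuting positive stable $P,Q$, the beta matrix function is $\mathfrak{B}(P,Q)=\Gamma(P)\Gamma(Q)\Gamma^{-1}(P+Q)=\int_0^1t^{P-I}(1-t)^{Q-I}dt$, where $\Gamma(P)=\int_0^\infty e^{-t}t^{P-I}dt$. For positive stable $A,B,P,Q,\mathbb{Y}$, $$\mathfrak{B}_{\mathbb{Y}}^{(A,B)}(P,Q)=\int_0^1 {}_1F_1\!\left(A;B;-\frac{\mathbb{Y}}{t(1-t)}\right)t^{P-I}(1-t)^{Q-I}\,dt .$$ The new extended Gauss hypergeometric matrix function is, for $|z|<1$, $${}_2F_1^{(A,B;\mathbb{Y})}(A_1,B_1;C_1;z)=\sum_{n=0}^\infty (A_1)_n\,\mathfrak{B}_{\mathbb{Y}}^{(A,B)}(B_1+nI,C_1-B_1)\,[\mathfrak{B}(B_1,C_1-B_1)]^{-1}\,\frac{z^n}{n!}.$$ *)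

theory Defs
  imports "HOL-Analysis.Analysis"
begin

text \<open>
  Square complex matrices of size \<open>r\<close> are rendered as \<open>complex^'r^'r\<close>.
  The class operations \<open>*\<close>, \<open>^\<close> and \<open>1\<close> on this type act entrywise, so the matrix product
  is \<open>**\<close>, the identity is \<open>mat 1\<close>, and scalar multiples, powers and exponentials of matrices are
  introduced here.
\<close>

definition scale_mat :: "complex \<Rightarrow> complex^'r^'r \<Rightarrow> complex^'r^'r"  (infixr \<open>*\<^sub>m\<close> 75)
  where "c *\<^sub>m M = (\<chi> i j. c * M $ i $ j)"

primrec mat_power :: "complex^'r^'r \<Rightarrow> nat \<Rightarrow> complex^'r^'r" where
  "mat_power M 0 = mat 1"
| "mat_power M (Suc n) = mat_power M n ** M"

definition mat_exp :: "complex^'r^'r \<Rightarrow> complex^'r^'r"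
  where "mat_exp M = (\<Sum>n. (1 / fact n) *\<^sub>m mat_power M n)"

text \<open>\<open>Ln\<close> is the principal logarithm, so this is \<open>s^M\<close> for \<open>s\<close> off the half-line \<open>(-\<infinity>, 0]\<close>;
  it is only used for such \<open>s\<close>.\<close>

definition mat_cpow :: "complex \<Rightarrow> complex^'r^'r \<Rightarrow> complex^'r^'r"
  where "mat_cpow s M = mat_exp (Ln s *\<^sub>m M)"

definition mat_eigenvalue :: "complex^'r^'r \<Rightarrow> complex \<Rightarrow> bool"
  where "mat_eigenvalue M l \<longleftrightarrow> (\<exists>v. v \<noteq> 0 \<and> M *v v = l *s v)"

definition positive_stable :: "complex^'r^'r \<Rightarrow> bool"
  where "positive_stable M \<longleftrightarrow> (\<forall>l. mat_eigenvalue M l \<longrightarrow> Re l > 0)"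

primrec mat_pochhammer :: "complex^'r^'r \<Rightarrow> nat \<Rightarrow> complex^'r^'r" where
  "mat_pochhammer M 0 = mat 1"
| "mat_pochhammer M (Suc n) = mat_pochhammer M n ** (M + mat (of_nat n))"

definition hyp1F1_mat :: "complex^'r^'r \<Rightarrow> complex^'r^'r \<Rightarrow> complex^'r^'r \<Rightarrow> complex^'r^'r"
  where "hyp1F1_mat A B W =
    (\<Sum>n. (1 / fact n) *\<^sub>m
      (mat_pochhammer A n ** matrix_inv (mat_pochhammer B n) ** mat_power W n))"

definition Gamma_mat :: "complex^'r^'r \<Rightarrow> complex^'r^'r"
  where "Gamma_mat P =
    (LBINT t:{0<..}. complex_of_real (exp (- t)) *\<^sub>m mat_cpow (complex_of_real t) (P - mat 1))"

definition Beta_mat :: "complex^'r^'r \<Rightarrow> complex^'r^'r \<Rightarrow> complex^'r^'r"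
  where "Beta_mat P Q = Gamma_mat P ** Gamma_mat Q ** matrix_inv (Gamma_mat (P + Q))"

text \<open>\<open>ext_Beta_mat A B Y P Q\<close> is the extended beta matrix function with upper parameters
  \<open>(A, B)\<close> and lower parameter \<open>Y\<close>.\<close>

definition ext_Beta_mat ::
  "complex^'r^'r \<Rightarrow> complex^'r^'r \<Rightarrow> complex^'r^'r \<Rightarrow> complex^'r^'r \<Rightarrow> complex^'r^'r \<Rightarrow> complex^'r^'r"
  where "ext_Beta_mat A B Y P Q =
    (LBINT t:{0<..<1}.
      hyp1F1_mat A B (complex_of_real (- (1 / (t * (1 - t)))) *\<^sub>m Y)
        ** mat_cpow (complex_of_real t) (P - mat 1)
        ** mat_cpow (complex_of_real (1 - t)) (Q - mat 1))"

definition ext_hyp2F1_mat ::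
  "complex^'r^'r \<Rightarrow> complex^'r^'r \<Rightarrow> complex^'r^'r \<Rightarrow>
   complex^'r^'r \<Rightarrow> complex^'r^'r \<Rightarrow> complex^'r^'r \<Rightarrow> complex \<Rightarrow> complex^'r^'r"
  where "ext_hyp2F1_mat A B Y A1 B1 C1 z =
    (\<Sum>n. (z ^ n / fact n) *\<^sub>m
      (mat_pochhammer A1 n ** ext_Beta_mat A B Y (B1 + mat (of_nat n)) (C1 - B1)
        ** matrix_inv (Beta_mat B1 (C1 - B1))))"

end

(*
  With K(t) = t^(B1-I) (1-t)^(C1-B1-I) and H(t) = 1F1(A; B; -Y/(t(1-t))), summing the series under the
  integral turns the extended Gauss function into an Euler integral of (1-zt)^(-A1) H(t) K(t). Since
  H(t) = H(1-t), the substitution t -> 1-t exchanges B1 and C1-B1 and replaces (1-zt)^(-A1) by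
  (1-z)^(-A1) (1-wt)^(-A1) with w = z/(z-1). The other two formulas are the same statement at
  1-1/z and z/(1+z).

  The analytic content is the absolute convergence of the integral, i.e. that 1F1(A; B; -sY) stays bounded
  as s -> infinity although A, B, Y do not commute. Kummer's equation, written as a first-order system for
  g and q = -s g' - A g, reads s g' = -A g - q, s q' = -s q Y + (bounded linear terms); a Lyapunov energy
  adapted to the positive stable matrices A and Y decreases along it for large s.
*)

theory Submission
  imports Defs "HOL-Computational_Algebra.Fundamental_Theorem_Algebra" "HOL-Real_Asymp.Real_Asymp"
begin

section \<open>Matrix algebra\<close>

text \<open>The obstacle is non-commutativity. In \<open>hyp1F1_mat\<close> the inverse Pochhammer
  symbol of \<open>B\<close> is locked between the symbol of \<open>A\<close> and the powers of
  \<open>Y\<close>, so the term with the lower parameter is not a multiple of the function, and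
  Kummer's equation does not close on a single unknown. Inserting a matrix \<open>M\<close> between
  the two symbols turns that term into the same function at \<open>M ** B\<close>. A finite system
  then comes from a chain \<open>P 0 = mat 1\<close>, ..., \<open>P m = 0\<close> with
  \<open>P j ** B = l j *\<^sub>m P j + P (Suc j)\<close>, read off from a factored annihilating
  polynomial of \<open>B\<close>; no normal form is used. Such chains for \<open>A\<close> and
  \<open>Y\<close> also give inner products in which these matrices are coercive. For
  \<open>B1\<close> and \<open>C1 - B1\<close> they give decay of the exponential, hence scalar
  bounds by powers of \<open>t\<close> and \<open>1 - t\<close> in the Euler integrand. A bounded
  1F1 is therefore enough: a beta density dominates. No commutation with \<open>A1\<close> is
  assumed, so its power stays on the far left and the inverse beta matrix on the far right. That
  \<open>B1\<close> and \<open>C1\<close> commute is used to exchange the two powers in the kernel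
  and the two Gamma factors.\<close>

lemma scale_mat_nth [simp]: "(c *\<^sub>m M) $ i $ j = c * M $ i $ j"
  by (simp add: scale_mat_def)

lemma mat_eqI: "(\<And>i j. (M::complex^'r^'r) $ i $ j = N $ i $ j) \<Longrightarrow> M = N"
  by (simp add: vec_eq_iff)

lemma scale_mat_simps [simp]:
  "0 *\<^sub>m M = 0" "1 *\<^sub>m M = M" "c *\<^sub>m 0 = 0" "(- c) *\<^sub>m M = - (c *\<^sub>m M)"
  "c *\<^sub>m (- M) = - (c *\<^sub>m M)" "c *\<^sub>m (d *\<^sub>m M) = (c * d) *\<^sub>m M"
  by (auto intro!: mat_eqI)

lemma scale_mat_distrib:
  "c *\<^sub>m (M + N) = c *\<^sub>m M + c *\<^sub>m N" "c *\<^sub>m (M - N) = c *\<^sub>m M - c *\<^sub>m N"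
  "(c + d) *\<^sub>m M = c *\<^sub>m M + d *\<^sub>m M" "(c - d) *\<^sub>m M = c *\<^sub>m M - d *\<^sub>m M"
  by (auto intro!: mat_eqI simp: algebra_simps)

lemma scale_mat_scaleR: "complex_of_real c *\<^sub>m M = c *\<^sub>R M"
  by (auto intro!: mat_eqI) (simp add: scaleR_conv_of_real)

lemma mult_scale_mat [simp]:
  "(c *\<^sub>m M) ** N = c *\<^sub>m (M ** N)" "M ** (c *\<^sub>m N) = c *\<^sub>m (M ** N)"
  by (auto intro!: mat_eqI simp: matrix_matrix_mult_def sum_distrib_left algebra_simps)

lemma matrix_mul_zero [simp]: "(0::complex^'r^'r) ** M = 0" "M ** (0::complex^'r^'r) = 0"
  by (auto intro!: mat_eqI simp: matrix_matrix_mult_def)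

lemma matrix_mul_uminus [simp]:
  "(- M) ** (N::complex^'r^'r) = - (M ** N)" "M ** (- (N::complex^'r^'r)) = - (M ** N)"
  by (simp_all add: vec_eq_iff matrix_matrix_mult_def sum_negf)

lemma matrix_mul_distrib:
  "(M + N) ** (L::complex^'r^'r) = M ** L + N ** L" "L ** (M + N) = L ** M + L ** (N::complex^'r^'r)"
  "(M - N) ** L = M ** L - N ** L" "L ** (M - N) = L ** M - L ** N"
  by (auto intro!: mat_eqI simp: matrix_matrix_mult_def algebra_simps sum.distrib sum_subtractf)

lemma mat_eq_scale: "(mat c :: complex^'r^'r) = c *\<^sub>m mat 1"
  by (auto intro!: mat_eqI simp: mat_def)

lemma mult_mat [simp]:
  "M ** (mat c :: complex^'r^'r) = c *\<^sub>m M" "(mat c :: complex^'r^'r) ** M = c *\<^sub>m M"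
  by (simp_all add: mat_eq_scale[of c])

lemma norm_scale_mat [simp]: "norm (c *\<^sub>m M) = norm c * norm M"
proof -
  have "norm ((c *\<^sub>m M) $ i) = norm c * norm (M $ i)" for i
    by (simp add: norm_vec_def norm_mult L2_set_right_distrib)
  then show ?thesis
    unfolding norm_vec_def[of "c *\<^sub>m M"] norm_vec_def[of M]
    by (simp add: L2_set_right_distrib)
qed

lemma bounded_bilinear_scale_mat: "bounded_bilinear ((*\<^sub>m) :: complex \<Rightarrow> complex^'r^'r \<Rightarrow> _)"
  by standard (auto intro!: mat_eqI exI[of _ 1] simp: algebra_simps)

lemma bounded_bilinear_matrix_mult:
  "bounded_bilinear ((**) :: complex^'r^'r \<Rightarrow> complex^'r^'r \<Rightarrow> complex^'r^'r)"
  unfolding bilinear_conv_bounded_bilinear[symmetric] bilinear_def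
  by (auto intro!: linearI simp: matrix_mul_distrib simp flip: scale_mat_scaleR)

interpretation mat_mult: bounded_bilinear "(**) :: complex^'r^'r \<Rightarrow> complex^'r^'r \<Rightarrow> complex^'r^'r"
  by (rule bounded_bilinear_matrix_mult)

interpretation mat_scale: bounded_bilinear "(*\<^sub>m) :: complex \<Rightarrow> complex^'r^'r \<Rightarrow> complex^'r^'r"
  by (rule bounded_bilinear_scale_mat)

text \<open>Some constant is enough, because it ends up only in bounds whose size is irrelevant.
  Where the exact factor matters, as in ratios of Pochhammer symbols, \<open>norm_scale_mat\<close>
  is used instead.\<close>

lemma norm_matrix_mult_bound:
  "\<exists>K>0. \<forall>(M :: complex^'r^'r) (N :: complex^'r^'r). norm (M ** N) \<le> K * norm M * norm N"
proof -
  from bounded_bilinear.pos_bounded[OF bounded_bilinear_matrix_mult[where 'r='r]]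
  obtain K where K: "K > 0" "\<forall>(M :: complex^'r^'r) (N :: complex^'r^'r). norm (M ** N) \<le> norm M * norm N * K"
    by (elim exE conjE)
  have "norm (M ** N) \<le> K * norm M * norm N" for M :: "complex^'r^'r" and N :: "complex^'r^'r"
    using K(2)[rule_format, of M N] by (simp only: mult_ac)
  with K(1) show ?thesis by blast
qed

lemma mat_power_commute:
  assumes "M ** N = N ** M"
  shows "mat_power M n ** N = N ** mat_power M n"
proof (induction n)
  case (Suc n)
  have "mat_power M n ** (M ** N) = (mat_power M n ** N) ** M"
    by (simp add: assms matrix_mul_assoc)
  also have "\<dots> = N ** (mat_power M n ** M)"
    by (simp add: Suc matrix_mul_assoc)
  finally show ?case by (simp add: matrix_mul_assoc)
qed simp

lemma mat_power_Suc_left: "mat_power M (Suc n) = M ** mat_power M n"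
  using mat_power_commute[of M M n] by simp

lemma mat_power_scale: "mat_power (c *\<^sub>m M) n = (c ^ n) *\<^sub>m mat_power M n"
  by (induction n) (simp_all add: mult.commute)

lemma matrix_inv_inverse:
  assumes "invertible (M::complex^'r^'r)"
  shows "matrix_inv M ** M = mat 1" "M ** matrix_inv M = mat 1"
  using assms someI_ex[of "\<lambda>N. M ** N = mat 1 \<and> N ** M = mat 1"]
  unfolding invertible_def matrix_inv_def by auto

lemma invertible_add_mat:
  assumes "\<And>l. mat_eigenvalue M l \<Longrightarrow> l \<noteq> - c"
  shows "invertible (M + mat c)"
  unfolding invertible_left_inverse matrix_left_invertible_ker
proof (intro allI impI)
  fix x assume "(M + mat c) *v x = 0"
  moreover have "mat c *v x = c *s x"
    by (simp add: matrix_vector_mult_def vec_eq_iff mat_def if_distrib if_distribR cong: if_cong)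
  then have "(M + mat c) *v x = M *v x + c *s x"
    by (simp only: matrix_vector_mult_add_rdistrib)
  ultimately have "M *v x + c *s x = 0" by simp
  then have "M *v x = (- c) *s x" by (simp add: vec_eq_iff add_eq_0_iff2)
  then show "x = 0" using assms[of "- c"] unfolding mat_eigenvalue_def by blast
qed

text \<open>A factor \<open>B + mat (of_nat n)\<close> is singular only if \<open>-n\<close> is an
  eigenvalue of \<open>B\<close>, which positive stability excludes.\<close>

lemma invertible_pochhammer:
  assumes "positive_stable B"
  shows "invertible (mat_pochhammer B n)"
proof (induction n)
  case 0
  show ?case by (auto simp: invertible_def intro!: exI[of _ "mat 1"])
next
  case (Suc n)
  have "invertible (B + mat (of_nat n))"
    using assms by (intro invertible_add_mat) (fastforce simp: positive_stable_def)
  with Suc show ?case by (simp add: invertible_mult)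
qed

lemma mat_pochhammer_commute:
  assumes "M ** N = N ** M"
  shows "mat_pochhammer M n ** N = N ** mat_pochhammer M n"
proof (induction n)
  case (Suc n)
  have "(M + mat (of_nat n)) ** N = N ** (M + mat (of_nat n))"
    using assms by (simp add: matrix_mul_distrib)
  then have "mat_pochhammer M n ** ((M + mat (of_nat n)) ** N)
      = (mat_pochhammer M n ** N) ** (M + mat (of_nat n))"
    by (simp only: matrix_mul_assoc)
  also have "\<dots> = N ** (mat_pochhammer M n ** (M + mat (of_nat n)))"
    by (simp only: Suc matrix_mul_assoc)
  finally show ?case by (simp only: mat_pochhammer.simps matrix_mul_assoc)
qed simp

text \<open>Here the lower parameter becomes a left factor, adjacent to whatever stands between the
  two Pochhammer symbols. Both the recurrence and the decay of the Kummer coefficients rest on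
  this.\<close>

lemma matrix_inv_pochhammer_Suc:
  assumes "positive_stable B"
  shows "(B + mat (of_nat n)) ** matrix_inv (mat_pochhammer B (Suc n)) = matrix_inv (mat_pochhammer B n)"
    (is "?L ** ?I1 = ?I0")
proof -
  have "mat_pochhammer B n ** (?L ** ?I1) = mat 1"
    using matrix_inv_inverse(2)[OF invertible_pochhammer[OF assms, of "Suc n"]]
    by (simp add: matrix_mul_assoc)
  then have "?I0 ** (mat_pochhammer B n ** (?L ** ?I1)) = ?I0" by simp
  then show ?thesis
    using matrix_inv_inverse(1)[OF invertible_pochhammer[OF assms, of n]]
    by (simp add: matrix_mul_assoc)
qed

section \<open>Annihilating products of linear factors\<close>

text \<open>Horner evaluation of a scalar polynomial at a matrix, written out because
  \<open>poly\<close> would rely on the entrywise product of the type.\<close>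

definition mat_poly :: "complex poly \<Rightarrow> complex^'r^'r \<Rightarrow> complex^'r^'r" where
  "mat_poly p A = fold_coeffs (\<lambda>a X. a *\<^sub>m mat 1 + A ** X) p 0"

lemma mat_poly_0 [simp]: "mat_poly 0 A = 0"
  by (simp add: mat_poly_def)

lemma mat_poly_pCons [simp]: "mat_poly (pCons a p) A = a *\<^sub>m mat 1 + A ** mat_poly p A"
  by (cases "p = 0 \<and> a = 0") (auto simp: mat_poly_def)

lemma mat_poly_add: "mat_poly (p + q) A = mat_poly p A + mat_poly q A"
  by (induction p q rule: poly_induct2) (simp_all add: matrix_mul_distrib scale_mat_distrib)

lemma mat_poly_smult: "mat_poly (smult c p) A = c *\<^sub>m mat_poly p A"
  by (induction p) (simp_all add: scale_mat_distrib)

lemma mat_poly_sum: "mat_poly (sum f S) A = (\<Sum>x\<in>S. mat_poly (f x) A)"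
  by (induction S rule: infinite_finite_induct) (simp_all add: mat_poly_add)

lemma mat_poly_monom: "mat_poly (monom c n) A = c *\<^sub>m mat_power A n"
  by (induction n) (simp_all add: monom_Suc mat_power_Suc_left monom_0 del: mat_power.simps(2))

lemma mat_poly_linear_mult: "mat_poly ([:- l, 1:] * q) A = (A - mat l) ** mat_poly q A"
  using mat_poly_add[of "smult (- l) q" "pCons 0 q" A]
  by (simp add: mat_poly_smult matrix_mul_distrib del: smult_minus_left)

lemma mat_poly_commute: "A ** mat_poly p A = mat_poly p A ** A"
  by (induction p) (simp_all add: matrix_mul_distrib matrix_mul_assoc)

lemma annihilating_poly_exists:
  fixes A :: "complex^'r^'r"
  obtains p where "p \<noteq> 0" "mat_poly p A = 0"
proof (cases "inj (mat_power A)")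
  \<comment> \<open>Linear dependence is a property of sets, so a repetition among the powers is
    treated separately.\<close>
  case False
  then obtain i j where "i \<noteq> j" "mat_power A i = mat_power A j" by (auto simp: inj_def)
  then have "monom 1 i + monom (-1) j \<noteq> (0 :: complex poly)"
    "mat_poly (monom 1 i + monom (-1) j) A = 0"
    by (auto simp: mat_poly_add mat_poly_monom poly_eq_iff dest!: spec[of _ i])
  then show ?thesis using that by blast
next
  case True
  \<comment> \<open>\<open>DIM\<close> is the real dimension, so the \<open>N + 1\<close> powers
    with exponents up to \<open>N\<close> are dependent over the reals; the real coefficients are
    then read as complex ones.\<close>
  define N where "N = DIM(complex^'r^'r)"
  have inj: "inj_on (mat_power A) {..N}" using True by (auto intro: inj_on_subset)
  have "dependent (mat_power A ` {..N})"
    using inj by (intro dependent_biggerset) (auto simp: card_image N_def)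
  then obtain u where u: "\<exists>v\<in>mat_power A ` {..N}. u v \<noteq> 0"
    "(\<Sum>v\<in>mat_power A ` {..N}. u v *\<^sub>R v) = 0"
    by (auto simp: dependent_finite)
  define c where "c k = complex_of_real (u (mat_power A k))" for k
  define p where "p = (\<Sum>k\<le>N. monom (c k) k)"
  have "mat_poly p A = (\<Sum>k\<le>N. c k *\<^sub>m mat_power A k)"
    by (simp add: p_def mat_poly_sum mat_poly_monom)
  also have "\<dots> = (\<Sum>v\<in>mat_power A ` {..N}. u v *\<^sub>R v)"
    by (simp add: sum.reindex[OF inj] c_def scale_mat_scaleR)
  finally have "mat_poly p A = 0" using u by simp
  moreover obtain k where "k \<le> N" "c k \<noteq> 0" using u(1) by (auto simp: c_def)
  then have "coeff p k \<noteq> 0" by (simp add: p_def coeff_sum sum.delta)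
  ultimately show ?thesis using that[of p] by force
qed

text \<open>A root \<open>l\<close> with \<open>Re l \<le> 0\<close> is no eigenvalue of
  \<open>A\<close>, so its factor is invertible and can be cancelled. A factor with
  \<open>Re l > 0\<close> commutes past the remaining polynomial and is absorbed into
  \<open>X\<close>, which is why \<open>X\<close> stays arbitrary in the induction on the
  degree.\<close>

lemma annihilating_factors:
  fixes A X :: "complex^'r^'r"
  assumes stable: "positive_stable A" and "p \<noteq> 0" and "mat_poly p A ** X = 0"
  shows "\<exists>ls. (\<forall>l\<in>set ls. Re l > 0) \<and> foldr (\<lambda>l Z. (A - mat l) ** Z) ls X = 0"
  using assms(2,3)
proof (induction "degree p" arbitrary: p X)
  case 0
  then obtain c where "p = [:c:]" "c \<noteq> 0" by (metis degree_eq_zeroE pCons_0_0)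
  then have "c *\<^sub>m X = 0" using 0 by simp
  then have "(1 / c) *\<^sub>m (c *\<^sub>m X) = 0" by simp
  then have "X = 0" using \<open>c \<noteq> 0\<close> by simp
  then show ?case by (intro exI[of _ "[]"]) simp
next
  case (Suc n)
  have "\<not> constant (poly p)" using Suc.hyps(2) by (simp add: constant_degree)
  then obtain l where "poly p l = 0" using fundamental_theorem_of_algebra by blast
  then obtain q where p: "p = [:- l, 1:] * q" by (auto simp: poly_eq_0_iff_dvd)
  with Suc.prems have q0: "q \<noteq> 0" by auto
  then have deg: "n = degree q" using Suc.hyps(2) unfolding p by (subst (asm) degree_mult_eq) auto
  have comm: "(A - mat l) ** mat_poly q A = mat_poly q A ** (A - mat l)"
    by (simp add: matrix_mul_distrib mat_poly_commute)
  have zero: "((A - mat l) ** mat_poly q A) ** X = 0"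
    using Suc.prems(2) unfolding p mat_poly_linear_mult .
  show ?case
  proof (cases "Re l > 0")
    case True
    have "mat_poly q A ** ((A - mat l) ** X) = 0"
      using zero unfolding comm by (simp add: matrix_mul_assoc)
    from Suc.hyps(1)[OF deg q0 this] obtain ls
      where "\<forall>l\<in>set ls. Re l > 0" "foldr (\<lambda>l Z. (A - mat l) ** Z) ls ((A - mat l) ** X) = 0"
      by blast
    with True show ?thesis by (intro exI[of _ "ls @ [l]"]) auto
  next
    case False
    have "invertible (A + mat (- l))"
      using stable False by (intro invertible_add_mat) (auto simp: positive_stable_def)
    moreover have "A + mat (- l) = A - mat l" by (auto intro!: mat_eqI simp: mat_def)
    ultimately have "matrix_inv (A - mat l) ** (A - mat l) = mat 1"
      using matrix_inv_inverse by metis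
    then have "mat_poly q A ** X = matrix_inv (A - mat l) ** (((A - mat l) ** mat_poly q A) ** X)"
      by (simp add: matrix_mul_assoc)
    with zero have "mat_poly q A ** X = 0" by simp
    from Suc.hyps(1)[OF deg q0 this] show ?thesis .
  qed
qed

text \<open>Stands in for a triangularisation: \<open>A\<close> acts on the chain \<open>P 0, P 1, \<dots>\<close> as a bidiagonal matrix.\<close>

lemma annihilating_chain:
  fixes A :: "complex^'r^'r"
  assumes "positive_stable A"
  obtains m P l where "P 0 = mat 1" "P m = 0" "\<And>j. j < m \<Longrightarrow> Re (l j) > 0"
    "\<And>j. j < m \<Longrightarrow> P j ** A = l j *\<^sub>m P j + P (Suc j)" "\<And>j. A ** P j = P j ** A"
proof -
  obtain p where p: "p \<noteq> 0" "mat_poly p A = 0" by (rule annihilating_poly_exists)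
  with annihilating_factors[OF assms, of p "mat 1"] obtain ls
    where ls: "\<forall>l\<in>set ls. Re l > 0" "foldr (\<lambda>l Z. (A - mat l) ** Z) ls (mat 1) = 0" by auto
  \<comment> \<open>\<open>foldr\<close> applies the last entry first; after reversal,
    \<open>P (Suc j)\<close> arises from \<open>P j\<close> by one new factor on the left.\<close>
  define rs where "rs = rev ls"
  define P where "P j = foldr (\<lambda>l Z. (A - mat l) ** Z) (rev (take j rs)) (mat 1)" for j
  have step: "P (Suc j) = (A - mat (rs ! j)) ** P j" if "j < length rs" for j
    using that by (simp add: P_def take_Suc_conv_app_nth)
  have comm: "A ** foldr (\<lambda>l Z. (A - mat l) ** Z) xs (mat 1)
      = foldr (\<lambda>l Z. (A - mat l) ** Z) xs (mat 1) ** A" for xs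
  proof (induction xs)
    case (Cons x xs)
    have "A ** (A - mat x) = (A - mat x) ** A" by (simp add: matrix_mul_distrib)
    then have "A ** ((A - mat x) ** Z) = (A - mat x) ** (A ** Z)" for Z :: "complex^'r^'r"
      by (simp only: matrix_mul_assoc)
    then show ?case by (simp add: Cons matrix_mul_assoc[symmetric])
  qed simp
  then have comm: "A ** P j = P j ** A" for j by (simp add: P_def)
  show ?thesis
  proof (rule that[of P "length rs" "\<lambda>j. rs ! j"])
    show "P (length rs) = 0" using ls by (simp add: P_def rs_def)
    show "Re (rs ! j) > 0" if "j < length rs" for j
      using ls(1) that by (metis nth_mem rs_def set_rev)
    show "P j ** A = (rs ! j) *\<^sub>m P j + P (Suc j)" if "j < length rs" for j
      using step[OF that] comm by (simp add: matrix_mul_distrib)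
  qed (use comm in \<open>auto simp: P_def\<close>)
qed

section \<open>Power series with matrix coefficients\<close>

definition mat_series :: "(nat \<Rightarrow> complex^'r^'r) \<Rightarrow> complex \<Rightarrow> complex^'r^'r" where
  "mat_series C c = (\<Sum>n. c ^ n *\<^sub>m C n)"

text \<open>Absolute convergence in the open disc of radius \<open>R\<close>, put as a condition on
  the norms of the coefficients so that it passes to sums, matrix multiples and termwise
  derivatives. An entire series satisfies it for every \<open>R\<close>.\<close>

definition mat_conv :: "(nat \<Rightarrow> complex^'r^'r) \<Rightarrow> real \<Rightarrow> bool" where
  "mat_conv C R \<longleftrightarrow> (\<forall>\<rho>\<ge>0. \<rho> < R \<longrightarrow> summable (\<lambda>n. norm (C n) * \<rho> ^ n))"

lemma mat_convD: "mat_conv C R \<Longrightarrow> 0 \<le> \<rho> \<Longrightarrow> \<rho> < R \<Longrightarrow> summable (\<lambda>n. norm (C n) * \<rho> ^ n)"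
  by (simp add: mat_conv_def)

lemma summable_norm_mat_series:
  assumes "mat_conv C R" "norm c < R"
  shows "summable (\<lambda>n. norm (c ^ n *\<^sub>m C n))"
  using mat_convD[OF assms(1), of "norm c"] assms(2) by (simp add: norm_power mult.commute)

lemma summable_mat_series:
  "mat_conv C R \<Longrightarrow> norm c < R \<Longrightarrow> summable (\<lambda>n. c ^ n *\<^sub>m C n)"
  by (rule summable_norm_cancel) (rule summable_norm_mat_series)

lemma mat_series_0 [simp]: "mat_series C 0 = C 0"
proof -
  have "mat_series C 0 = (\<Sum>n\<in>{0}. 0 ^ n *\<^sub>m C n)"
    unfolding mat_series_def by (rule suminf_finite) (auto simp: power_0_left)
  then show ?thesis by simp
qed

lemma bounded_linear_mat_series:
  assumes "bounded_linear L" "mat_conv C R" "norm c < R"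
    and "\<And>c M. L (c *\<^sub>m M) = c *\<^sub>m L M"
  shows "mat_series (\<lambda>n. L (C n)) c = L (mat_series C c)"
  unfolding mat_series_def
  using bounded_linear.suminf[OF assms(1) summable_mat_series[OF assms(2,3)]] assms(4) by simp

lemma mat_series_mult_left:
  "mat_conv C R \<Longrightarrow> norm c < R \<Longrightarrow> mat_series (\<lambda>n. M ** C n) c = M ** mat_series C c"
  by (rule bounded_linear_mat_series) (simp_all add: mat_mult.bounded_linear_right)

lemma mat_series_mult_right:
  "mat_conv C R \<Longrightarrow> norm c < R \<Longrightarrow> mat_series (\<lambda>n. C n ** M) c = mat_series C c ** M"
  by (rule bounded_linear_mat_series) (simp_all add: mat_mult.bounded_linear_left)

lemma mat_series_scale:
  "mat_conv C R \<Longrightarrow> norm c < R \<Longrightarrow> mat_series (\<lambda>n. d *\<^sub>m C n) c = d *\<^sub>m mat_series C c"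
  by (rule bounded_linear_mat_series) (simp_all add: mat_scale.bounded_linear_right mult.commute)

lemma mat_series_uminus:
  "mat_conv C R \<Longrightarrow> norm c < R \<Longrightarrow> mat_series (\<lambda>n. - C n) c = - mat_series C c"
  by (rule bounded_linear_mat_series)
    (simp_all add: bounded_linear_minus[OF bounded_linear_ident])

lemma mat_series_add:
  assumes "mat_conv C R" "mat_conv D R" "norm c < R"
  shows "mat_series (\<lambda>n. C n + D n) c = mat_series C c + mat_series D c"
  unfolding mat_series_def
  using suminf_add[OF summable_mat_series[OF assms(1,3)] summable_mat_series[OF assms(2,3)]]
  by (simp add: scale_mat_distrib)

lemma mat_conv_bounded:
  assumes "mat_conv C R" "\<And>n. norm (D n) \<le> k * norm (C n)"
  shows "mat_conv D R"
  unfolding mat_conv_def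
proof (intro allI impI)
  fix \<rho> :: real assume \<rho>: "0 \<le> \<rho>" "\<rho> < R"
  have "norm (norm (D n) * \<rho> ^ n) \<le> k * (norm (C n) * \<rho> ^ n)" for n
    using mult_right_mono[OF assms(2), of "\<rho> ^ n" n] \<rho> by (simp add: mult.assoc)
  then show "summable (\<lambda>n. norm (D n) * \<rho> ^ n)"
    by (intro summable_comparison_test[OF _ summable_mult[OF mat_convD[OF assms(1) \<rho>]]]) auto
qed

lemma mat_conv_add:
  assumes "mat_conv C R" "mat_conv D R"
  shows "mat_conv (\<lambda>n. C n + D n) R"
  unfolding mat_conv_def
proof (intro allI impI)
  fix \<rho> :: real assume \<rho>: "0 \<le> \<rho>" "\<rho> < R"
  have "norm (norm (C n + D n) * \<rho> ^ n) \<le> norm (C n) * \<rho> ^ n + norm (D n) * \<rho> ^ n" for n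
    using mult_right_mono[OF norm_triangle_ineq, of "\<rho> ^ n" "C n" "D n"] \<rho>
    by (simp add: algebra_simps)
  then show "summable (\<lambda>n. norm (C n + D n) * \<rho> ^ n)"
    by (intro summable_comparison_test[OF _ summable_add[OF mat_convD[OF assms(1) \<rho>] mat_convD[OF assms(2) \<rho>]]])
      auto
qed

lemma mat_conv_mult_left:
  fixes C :: "nat \<Rightarrow> complex^'r^'r"
  shows "mat_conv C R \<Longrightarrow> mat_conv (\<lambda>n. M ** C n) R"
proof -
  from norm_matrix_mult_bound[where 'r='r] obtain K where K: "K > 0"
    "\<forall>(M :: complex^'r^'r) (N :: complex^'r^'r). norm (M ** N) \<le> K * norm M * norm N"
    by (elim exE conjE)
  have "norm (M ** C n) \<le> (K * norm M) * norm (C n)" for n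
    using K(2) by (simp only: mult_ac)
  from mat_conv_bounded[OF _ this] show "mat_conv C R \<Longrightarrow> ?thesis" .
qed

lemma mat_conv_mult_right:
  fixes C :: "nat \<Rightarrow> complex^'r^'r"
  shows "mat_conv C R \<Longrightarrow> mat_conv (\<lambda>n. C n ** M) R"
proof -
  from norm_matrix_mult_bound[where 'r='r] obtain K where K: "K > 0" "\<forall>(M :: complex^'r^'r) (N :: complex^'r^'r). norm (M ** N) \<le> K * norm M * norm N"
    by (elim exE conjE)
  have "norm (C n ** M) \<le> (K * norm M) * norm (C n)" for n
    using K(2)[rule_format, of "C n" M] by (simp only: mult_ac)
  from mat_conv_bounded[OF _ this] show "mat_conv C R \<Longrightarrow> ?thesis" .
qed

lemma mat_conv_scale: "mat_conv C R \<Longrightarrow> mat_conv (\<lambda>n. d *\<^sub>m C n) R"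
  by (rule mat_conv_bounded[where k = "norm d"]) auto

lemma mat_conv_uminus: "mat_conv C R \<Longrightarrow> mat_conv (\<lambda>n. - C n) R"
  by (rule mat_conv_bounded[where k = 1]) auto

definition mat_diffs :: "(nat \<Rightarrow> complex^'r^'r) \<Rightarrow> nat \<Rightarrow> complex^'r^'r" where
  "mat_diffs C n = of_nat (Suc n) *\<^sub>m C (Suc n)"

lemma mat_conv_diffs:
  assumes "mat_conv C R"
  shows "mat_conv (mat_diffs C) R"
  unfolding mat_conv_def
proof (intro allI impI)
  fix \<rho> :: real assume \<rho>: "0 \<le> \<rho>" "\<rho> < R"
  have "summable (\<lambda>n. diffs (\<lambda>n. norm (C n)) n * \<rho> ^ n)"
  proof (rule termdiff_converges[where K = R])
    fix x :: real assume "norm x < R"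
    then have "summable (\<lambda>n. norm (norm (C n) * x ^ n))"
      using mat_convD[OF assms, of "norm x"] by (simp add: norm_mult norm_power abs_mult power_abs)
    then show "summable (\<lambda>n. norm (C n) * x ^ n)" by (rule summable_norm_cancel)
  qed (use \<rho> in auto)
  moreover have "norm (mat_diffs C n) = diffs (\<lambda>n. norm (C n)) n" for n
    unfolding mat_diffs_def diffs_def norm_scale_mat norm_of_nat ..
  ultimately show "summable (\<lambda>n. norm (mat_diffs C n) * \<rho> ^ n)" by simp
qed

lemma mat_conv_of_nat:
  assumes "mat_conv C R"
  shows "mat_conv (\<lambda>n. of_nat n *\<^sub>m C n) R"
  unfolding mat_conv_def
proof (intro allI impI)
  fix \<rho> :: real assume \<rho>: "0 \<le> \<rho>" "\<rho> < R"
  have "summable (\<lambda>n. \<rho> * (norm (mat_diffs C n) * \<rho> ^ n))"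
    by (intro summable_mult mat_convD[OF mat_conv_diffs[OF assms] \<rho>])
  then show "summable (\<lambda>n. norm (of_nat n *\<^sub>m C n) * \<rho> ^ n)"
    unfolding mat_diffs_def by (subst summable_Suc_iff[symmetric])
      (simp add: mult_ac del: of_nat_Suc)
qed

lemma mat_series_diffs_mult:
  assumes "mat_conv C R" "norm c < R"
  shows "c *\<^sub>m mat_series (mat_diffs C) c = mat_series (\<lambda>n. of_nat n *\<^sub>m C n) c"
proof -
  have "mat_series (\<lambda>n. of_nat n *\<^sub>m C n) c = (\<Sum>n. c ^ Suc n *\<^sub>m (of_nat (Suc n) *\<^sub>m C (Suc n)))"
    unfolding mat_series_def
    using suminf_split_head[OF summable_mat_series[OF mat_conv_of_nat[OF assms(1)] assms(2)]]
    by simp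
  also have "\<dots> = (\<Sum>n. c *\<^sub>m (c ^ n *\<^sub>m mat_diffs C n))"
    by (simp add: mat_diffs_def mult_ac del: of_nat_Suc)
  also have "\<dots> = c *\<^sub>m mat_series (mat_diffs C) c"
    unfolding mat_series_def
    by (intro bounded_linear.suminf[OF mat_scale.bounded_linear_right, symmetric]
        summable_mat_series[OF mat_conv_diffs[OF assms(1)] assms(2)])
  finally show ?thesis ..
qed

lemma mat_series_nth:
  fixes C :: "nat \<Rightarrow> complex^'r^'r"
  assumes "mat_conv C R" "norm c < R"
  shows "mat_series C c $ i $ j = (\<Sum>n. C n $ i $ j * c ^ n)"
proof -
  have "bounded_linear (\<lambda>M::complex^'r^'r. M $ i $ j)"
    using bounded_linear_compose[OF bounded_linear_vec_nth bounded_linear_vec_nth] .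
  from bounded_linear.suminf[OF this summable_mat_series[OF assms]]
  show ?thesis by (simp add: mat_series_def mult.commute)
qed

text \<open>Every entry is a scalar complex power series, so scalar termwise differentiation
  applies, and the entries are reassembled over the standard basis.\<close>

lemma mat_series_has_derivative:
  fixes C :: "nat \<Rightarrow> complex^'r^'r"
  assumes "mat_conv C R" "norm c < R"
  shows "(mat_series C has_derivative (\<lambda>h. h *\<^sub>m mat_series (mat_diffs C) c)) (at c)"
proof -
  \<comment> \<open>Termwise differentiation asks for convergence at a point beyond
    \<open>c\<close>; \<open>\<rho>\<close> supplies it.\<close>
  obtain \<rho> where \<rho>: "norm c < \<rho>" "\<rho> < R" using dense[OF assms(2)] by blast
  then have \<rho>0: "0 \<le> \<rho>" using norm_ge_zero[of c] by linarith
  have nth: "((\<lambda>c. mat_series C c $ i $ j) has_derivative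
      (\<lambda>h. (h *\<^sub>m mat_series (mat_diffs C) c) $ i $ j)) (at c)" for i j
  proof -
    have le: "norm (M $ i $ j) \<le> norm M" for M :: "complex^'r^'r"
      by (rule order_trans[OF Finite_Cartesian_Product.norm_nth_le Finite_Cartesian_Product.norm_nth_le])
    have "norm (norm (C n $ i $ j * complex_of_real \<rho> ^ n)) \<le> norm (C n) * \<rho> ^ n" for n
      using mult_right_mono[OF le, of "\<rho> ^ n" "C n"] \<rho>0
      by (simp add: norm_mult norm_power)
    then have "summable (\<lambda>n. norm (C n $ i $ j * complex_of_real \<rho> ^ n))"
      by (intro summable_comparison_test'[OF mat_convD[OF assms(1) \<rho>0 \<rho>(2)]])
    then have "summable (\<lambda>n. C n $ i $ j * complex_of_real \<rho> ^ n)" by (rule summable_norm_cancel)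
    then have "((\<lambda>c. \<Sum>n. C n $ i $ j * c ^ n) has_field_derivative
        (\<Sum>n. diffs (\<lambda>n. C n $ i $ j) n * c ^ n)) (at c)"
      using \<rho> norm_ge_zero[of c] by (intro termdiffs_strong) auto
    also have "(\<Sum>n. diffs (\<lambda>n. C n $ i $ j) n * c ^ n) = mat_series (mat_diffs C) c $ i $ j"
      using mat_series_nth[OF mat_conv_diffs[OF assms(1)] assms(2), of i j]
      by (simp add: mat_diffs_def diffs_def del: of_nat_Suc)
    finally have der: "((\<lambda>c. \<Sum>n. C n $ i $ j * c ^ n) has_derivative
        (\<lambda>h. (h *\<^sub>m mat_series (mat_diffs C) c) $ i $ j)) (at c)"
      by (simp add: has_field_derivative_def mult_commute_abs)
    have eq: "(\<Sum>n. C n $ i $ j * x ^ n) = mat_series C x $ i $ j" if "x \<in> ball 0 R" for x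
      using mat_series_nth[OF assms(1), of x i j] that by simp
    show ?thesis
      by (rule has_derivative_transform_within_open[OF der open_ball[of 0 R] _ eq]) (use assms(2) in auto)
  qed
  show ?thesis
    by (subst has_derivative_componentwise_within)
      (auto simp: Basis_vec_def inner_axis simp del: scale_mat_nth intro!: has_derivative_inner_left nth)
qed

lemma mat_series_has_vector_derivative:
  assumes "mat_conv C R" "norm (\<phi> x) < R" "(\<phi> has_vector_derivative \<phi>') (at x within S)"
  shows "((\<lambda>x. mat_series C (\<phi> x)) has_vector_derivative
    (\<phi>' *\<^sub>m mat_series (mat_diffs C) (\<phi> x))) (at x within S)"
  using vector_derivative_diff_chain_within[OF assms(3)
      has_derivative_at_withinI[OF mat_series_has_derivative[OF assms(1,2)]]]
  by (simp add: o_def)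

lemma mat_series_has_vector_derivative_of_real:
  assumes "\<And>R. mat_conv C R"
  shows "((\<lambda>x. mat_series C (complex_of_real x)) has_vector_derivative
    mat_series (mat_diffs C) (complex_of_real x)) (at x within S)"
proof -
  have "(complex_of_real has_vector_derivative 1) (at x within S)"
    using has_vector_derivative_of_real[OF DERIV_ident] by simp
  from mat_series_has_vector_derivative[OF assms _ this, of "norm (complex_of_real x) + 1"]
  show ?thesis by simp
qed

text \<open>A ratio test in which the bounds on the quotients need only converge. The limit
  \<open>q = 0\<close> serves the exponential and the Kummer series, \<open>q = 1\<close> the
  binomial series of radius one.\<close>

lemma summable_ratio_limit:
  fixes u :: "nat \<Rightarrow> real"
  assumes "\<And>n. u n \<ge> 0" "\<forall>\<^sub>F n in sequentially. u (Suc n) \<le> r n * u n" "r \<longlonglongrightarrow> q"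
    and "\<rho> \<ge> 0" "q * \<rho> < 1"
  shows "summable (\<lambda>n. u n * \<rho> ^ n)"
proof -
  obtain d where d: "q * \<rho> < d" "d < 1" using dense[OF assms(5)] by blast
  have "(\<lambda>n. r n * \<rho>) \<longlonglongrightarrow> q * \<rho>" by (intro tendsto_intros assms(3))
  from order_tendstoD(2)[OF this d(1)] assms(2)
  have "\<forall>\<^sub>F n in sequentially. r n * \<rho> < d \<and> u (Suc n) \<le> r n * u n" by eventually_elim simp
  then obtain N where N: "\<And>n. n \<ge> N \<Longrightarrow> r n * \<rho> < d \<and> u (Suc n) \<le> r n * u n"
    by (auto simp: eventually_sequentially)
  show ?thesis
  proof (rule summable_ratio_test[OF d(2), of N])
    fix n assume n: "n \<ge> N"
    have "u (Suc n) * \<rho> ^ Suc n \<le> (r n * u n) * \<rho> ^ Suc n"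
      using N[OF n] assms(4) by (intro mult_right_mono) auto
    also have "\<dots> = (r n * \<rho>) * (u n * \<rho> ^ n)" by simp
    also have "\<dots> \<le> d * (u n * \<rho> ^ n)"
      using N[OF n] assms(1)[of n] assms(4) by (intro mult_right_mono) auto
    finally show "norm (u (Suc n) * \<rho> ^ Suc n) \<le> d * norm (u n * \<rho> ^ n)"
      using assms(1,4) by (simp add: abs_mult)
  qed
qed

section \<open>The matrix exponential\<close>

lemma mat_exp_scale: "mat_exp (c *\<^sub>m M) = mat_series (\<lambda>n. (1 / fact n) *\<^sub>m mat_power M n) c"
  by (simp add: mat_exp_def mat_series_def mat_power_scale)

lemma norm_fact_scale: "norm ((1 / fact n) *\<^sub>m M) = norm M / fact n"
  by (simp add: norm_divide)

lemma mat_conv_exp: "mat_conv (\<lambda>n. (1 / fact n) *\<^sub>m mat_power (M::complex^'r^'r) n) R"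
  unfolding mat_conv_def
proof (intro allI impI)
  from norm_matrix_mult_bound[where 'r='r] obtain K where K: "K > 0"
    "\<forall>(M :: complex^'r^'r) (N :: complex^'r^'r). norm (M ** N) \<le> K * norm M * norm N"
    by (elim exE conjE)
  fix \<rho> :: real assume "0 \<le> \<rho>"
  show "summable (\<lambda>n. norm ((1 / fact n) *\<^sub>m mat_power M n) * \<rho> ^ n)"
  proof (rule summable_ratio_limit[where q = 0])
    show "(\<lambda>n. K * norm M / (real n + 1)) \<longlonglongrightarrow> 0"
      by real_asymp
    show "\<forall>\<^sub>F n in sequentially. norm ((1 / fact (Suc n)) *\<^sub>m mat_power M (Suc n))
        \<le> K * norm M / (real n + 1) * norm ((1 / fact n) *\<^sub>m mat_power M n)"
    proof (rule always_eventually, rule allI)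
      fix n
      have "norm (mat_power M (Suc n)) / fact (Suc n) \<le> (K * norm (mat_power M n) * norm M) / fact (Suc n)"
        using K(2)[rule_format, of "mat_power M n" M] by (intro divide_right_mono) auto
      then show "norm ((1 / fact (Suc n)) *\<^sub>m mat_power M (Suc n))
        \<le> K * norm M / (real n + 1) * norm ((1 / fact n) *\<^sub>m mat_power M n)"
        unfolding norm_fact_scale by (simp add: mult_ac add.commute)
    qed
  qed (use \<open>0 \<le> \<rho>\<close> in auto)
qed

lemma mat_exp_0 [simp]: "mat_exp 0 = mat 1"
  using mat_exp_scale[of 0 0] by simp

lemma mat_exp_commute:
  fixes M N :: "complex^'r^'r"
  assumes "M ** N = N ** M"
  shows "mat_exp M ** N = N ** mat_exp M"
  using mat_series_mult_left[OF mat_conv_exp, of 1 2 N M] mat_series_mult_right[OF mat_conv_exp, of 1 2 M N]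
    mat_exp_scale[of 1 M] mat_power_commute[OF assms] by simp

lemma mat_exp_has_vector_derivative:
  assumes "(\<phi> has_vector_derivative \<phi>') (at x within S)"
  shows "((\<lambda>x. mat_exp (\<phi> x *\<^sub>m M)) has_vector_derivative
    (\<phi>' *\<^sub>m (M ** mat_exp (\<phi> x *\<^sub>m M)))) (at x within S)"
proof -
  have "mat_diffs (\<lambda>n. (1 / fact n) *\<^sub>m mat_power M n) = (\<lambda>n. M ** ((1 / fact n) *\<^sub>m mat_power M n))"
    by (rule ext) (simp add: mat_diffs_def mat_power_Suc_left field_simps del: mat_power.simps(2) of_nat_Suc)
  then have "mat_series (mat_diffs (\<lambda>n. (1 / fact n) *\<^sub>m mat_power M n)) (\<phi> x) = M ** mat_exp (\<phi> x *\<^sub>m M)"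
    using mat_series_mult_left[OF mat_conv_exp, of "\<phi> x" "norm (\<phi> x) + 1" M M]
    by (simp add: mat_exp_scale)
  then show ?thesis
    using mat_series_has_vector_derivative[OF mat_conv_exp _ assms, of "norm (\<phi> x) + 1" M]
    by (simp add: mat_exp_scale)
qed

lemma continuous_on_mat_exp:
  assumes "continuous_on S f"
  shows "continuous_on S (\<lambda>x. mat_exp (f x *\<^sub>m M))"
proof -
  have "isCont (mat_series (\<lambda>n. (1 / fact n) *\<^sub>m mat_power M n)) c" for c
    using mat_series_has_derivative[OF mat_conv_exp, of c "norm c + 1" M] has_derivative_continuous by auto
  then have "continuous_on UNIV (mat_series (\<lambda>n. (1 / fact n) *\<^sub>m mat_power M n))"
    by (simp add: continuous_on_eq_continuous_at)
  from continuous_on_compose2[OF this assms] show ?thesis by (simp add: mat_exp_scale)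
qed

text \<open>The two terms of the product rule cancel, so the product has derivative zero. This
  conservation law yields inverses of exponentials, the addition law, the splitting off of scalar
  matrices and the binomial series, without rearranging double series.\<close>

lemma mat_linear_ode_constant:
  assumes X: "\<And>x. x \<in> {0..1} \<Longrightarrow> (X has_vector_derivative (\<phi>' x *\<^sub>m (X x ** M))) (at x within {0..1})"
    and \<phi>: "\<And>x. x \<in> {0..1} \<Longrightarrow> (\<phi> has_vector_derivative \<phi>' x) (at x within {0..1})"
  shows "X 1 ** mat_exp (- \<phi> 1 *\<^sub>m M) = X 0 ** mat_exp (- \<phi> 0 *\<^sub>m M)"
proof -
  have "((\<lambda>x. X x ** mat_exp (- \<phi> x *\<^sub>m M)) has_vector_derivative 0) (at x within {0..1})"
    if x: "x \<in> {0..1}" for x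
  proof -
    have "((\<lambda>x. X x ** mat_exp (- \<phi> x *\<^sub>m M)) has_vector_derivative
       (X x ** (- \<phi>' x *\<^sub>m (M ** mat_exp (- \<phi> x *\<^sub>m M))) + (\<phi>' x *\<^sub>m (X x ** M)) ** mat_exp (- \<phi> x *\<^sub>m M)))
       (at x within {0..1})"
      by (intro mat_mult.has_vector_derivative X mat_exp_has_vector_derivative
          has_vector_derivative_minus \<phi> x)
    then show ?thesis by (simp add: matrix_mul_assoc)
  qed
  then obtain c where "\<And>x. x \<in> {0..1} \<Longrightarrow> X x ** mat_exp (- \<phi> x *\<^sub>m M) = c"
    using has_derivative_zero_constant[of "{0..1::real}" "\<lambda>x. X x ** mat_exp (- \<phi> x *\<^sub>m M)"]
    by (auto simp: has_vector_derivative_def)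
  then show ?thesis by simp
qed

lemma has_vector_derivative_of_real_mult:
  "((\<lambda>x. complex_of_real x * c) has_vector_derivative c) (at x within S)"
  by (rule has_vector_derivative_eq_rhs, rule has_vector_derivative_mult_left,
      rule has_vector_derivative_of_real, rule DERIV_ident) simp

lemma mat_exp_path_has_vector_derivative:
  "((\<lambda>x. mat_exp ((of_real x * c) *\<^sub>m M)) has_vector_derivative
    (c *\<^sub>m (mat_exp ((of_real x * c) *\<^sub>m M) ** M))) (at x within S)"
  using mat_exp_has_vector_derivative[OF has_vector_derivative_of_real_mult, where M = M]
    mat_exp_commute[of "(of_real x * c) *\<^sub>m M" M]
  by simp

lemma mat_exp_minus: "mat_exp (c *\<^sub>m M) ** mat_exp (- c *\<^sub>m M) = mat 1"
  using mat_linear_ode_constant[OF mat_exp_path_has_vector_derivative has_vector_derivative_of_real_mult,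
      of c M]
  by simp

lemma mat_linear_ode_unique:
  assumes X: "\<And>x. x \<in> {0..1} \<Longrightarrow> (X has_vector_derivative (\<phi>' x *\<^sub>m (X x ** M))) (at x within {0..1})"
    and \<phi>: "\<And>x. x \<in> {0..1} \<Longrightarrow> (\<phi> has_vector_derivative \<phi>' x) (at x within {0..1})"
    and 0: "\<phi> 0 = 0"
  shows "X 1 = X 0 ** mat_exp (\<phi> 1 *\<^sub>m M)"
proof -
  have "X 1 ** (mat_exp (- \<phi> 1 *\<^sub>m M) ** mat_exp (\<phi> 1 *\<^sub>m M)) = X 0 ** mat_exp (\<phi> 1 *\<^sub>m M)"
    using mat_linear_ode_constant[OF X \<phi>] 0 by (simp add: matrix_mul_assoc)
  then show ?thesis using mat_exp_minus[of "- \<phi> 1" M] by simp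
qed

lemma mat_exp_add: "mat_exp ((a + b) *\<^sub>m M) = mat_exp (b *\<^sub>m M) ** mat_exp (a *\<^sub>m M)"
proof -
  have "((\<lambda>x. mat_exp ((of_real x * a + b) *\<^sub>m M)) has_vector_derivative
      (a *\<^sub>m (mat_exp ((of_real x * a + b) *\<^sub>m M) ** M))) (at x within {0..1})" for x
  proof -
    have "((\<lambda>x. of_real x * a + b) has_vector_derivative a) (at x within {0..1})"
      using has_vector_derivative_add[OF has_vector_derivative_of_real_mult has_vector_derivative_const]
      by simp
    from mat_exp_has_vector_derivative[OF this, of M] mat_exp_commute[of "(of_real x * a + b) *\<^sub>m M" M]
    show ?thesis by simp
  qed
  from mat_linear_ode_unique[OF this has_vector_derivative_of_real_mult] show ?thesis by simp
qed

text \<open>Both sides are the value at \<open>x = 1\<close> of the solution of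
  \<open>X' = c X (M + d)\<close> that starts at the identity. It later extracts
  \<open>t ^ n\<close> and \<open>1 / t\<close> from matrix powers of \<open>t\<close>.\<close>

lemma mat_exp_add_mat: "mat_exp (c *\<^sub>m (M + mat d)) = exp (c * d) *\<^sub>m mat_exp (c *\<^sub>m M)"
proof -
  define X where "X x = exp (of_real x * (c * d)) *\<^sub>m mat_exp ((of_real x * c) *\<^sub>m M)" for x :: real
  have "(X has_vector_derivative (c *\<^sub>m (X x ** (M + mat d)))) (at x within {0..1})" for x
  proof -
    have "((\<lambda>x. exp (of_real x * (c * d))) has_vector_derivative (c * d) * exp (of_real x * (c * d)))
        (at x within {0..1})"
      using field_vector_diff_chain_within[OF has_vector_derivative_of_real_mult DERIV_subset[OF DERIV_exp subset_UNIV],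
          of "c * d" x "{0..1}"]
      by (simp add: o_def)
    from mat_scale.has_vector_derivative[OF this mat_exp_path_has_vector_derivative, of c M]
    show ?thesis
      unfolding X_def by (simp add: matrix_mul_distrib scale_mat_distrib mult_ac)
  qed
  from mat_linear_ode_unique[OF this has_vector_derivative_of_real_mult] show ?thesis
    by (simp add: X_def)
qed

section \<open>Lyapunov forms\<close>

text \<open>A real inner product, at least as large as the standard one, in which \<open>T\<close>
  is coercive. It is the Lyapunov certificate that solutions of \<open>x' = - T x\<close> decay at
  rate \<open>c\<close>.\<close>

definition lyapunov_form :: "('a::euclidean_space \<Rightarrow> 'a \<Rightarrow> real) \<Rightarrow> ('a \<Rightarrow> 'a) \<Rightarrow> real \<Rightarrow> bool" where
  "lyapunov_form f T c \<longleftrightarrow> bounded_bilinear f \<and> (\<forall>x y. f x y = f y x) \<and> (\<forall>x. (norm x)\<^sup>2 \<le> f x x)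
    \<and> c > 0 \<and> (\<forall>x. c * f x x \<le> f (T x) x)"

lemma lyapunov_formD:
  assumes "lyapunov_form f T c"
  shows "bounded_bilinear f" "f x y = f y x" "(norm x)\<^sup>2 \<le> f x x" "c > 0" "c * f x x \<le> f (T x) x"
  using assms by (auto simp: lyapunov_form_def)

text \<open>The geometric weights make the off-diagonal terms of the bidiagonal operator negligible.\<close>

lemma lyapunov_form_exists:
  fixes T :: "'a::euclidean_space \<Rightarrow> 'a" and p :: "nat \<Rightarrow> 'a \<Rightarrow> 'a"
  assumes lin: "\<And>j. linear (p j)" and p0: "\<And>x. p 0 x = x" and pm: "\<And>x. p m x = 0"
    and \<alpha>: "\<alpha> > 0"
    and T: "\<And>j x. j < m \<Longrightarrow>
      \<alpha> * (norm (p j x))\<^sup>2 - norm (p (Suc j) x) * norm (p j x) \<le> inner (p j (T x)) (p j x)"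
  shows "\<exists>f c. lyapunov_form f T c"
proof -
  \<comment> \<open>With this ratio the weighted off-diagonal term equals
    \<open>\<alpha> / 2\<close> times a product of neighbours, hence is at most
    \<open>\<alpha> / 4 * (u j + u (Suc j))\<close>. Summation then costs half of
    \<open>\<alpha>\<close>.\<close>
  define k where "k = 2 / \<alpha>"
  have k: "k > 0" using \<alpha> by (simp add: k_def)
  define f where "f x y = (\<Sum>j<m. (k ^ j)\<^sup>2 * inner (p j x) (p j y))" for x y
  have "bilinear f"
    unfolding bilinear_def f_def
    by (auto intro!: linearI simp: linear_add[OF lin] linear_cmul[OF lin] inner_add_left
        inner_add_right algebra_simps sum.distrib sum_distrib_left)
  then have "bounded_bilinear f" by (simp add: bilinear_conv_bounded_bilinear)
  moreover have "f x y = f y x" for x y by (simp add: f_def inner_commute)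
  moreover have "(norm x)\<^sup>2 \<le> f x x" for x
  proof (cases m)
    case 0
    then show ?thesis using p0[of x] pm[of x] by (simp add: f_def)
  next
    case (Suc n)
    then have "(k ^ 0)\<^sup>2 * inner (p 0 x) (p 0 x) \<le> f x x"
      unfolding f_def by (intro member_le_sum) auto
    then show ?thesis by (simp add: p0 power2_norm_eq_inner)
  qed
  moreover have "\<alpha> / 2 * f x x \<le> f (T x) x" for x
  proof -
    define u where "u j = (k ^ j * norm (p j x))\<^sup>2" for j
    have u: "(\<Sum>j<m. u j) = f x x"
      by (simp add: f_def u_def power_mult_distrib power2_norm_eq_inner)
    \<comment> \<open>Shifting the index loses \<open>u 0\<close> and gains \<open>u m\<close>,
      which vanishes because the chain ends at \<open>p m\<close>.\<close>
    have "(\<Sum>j<m. u (Suc j)) + u 0 = (\<Sum>j<m. u j) + u m"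
      by (metis add.commute sum.lessThan_Suc sum.lessThan_Suc_shift)
    moreover have "u m = 0" "u 0 \<ge> 0" by (simp_all add: u_def pm)
    ultimately have shift: "(\<Sum>j<m. u (Suc j)) \<le> f x x" using u by linarith
    have "\<alpha> * u j - \<alpha> / 4 * (u j + u (Suc j)) \<le> (k ^ j)\<^sup>2 * inner (p j (T x)) (p j x)"
      if "j < m" for j
    proof -
      define a b where "a = k ^ j * norm (p j x)" and "b = k ^ Suc j * norm (p (Suc j) x)"
      have "(k ^ j)\<^sup>2 * (norm (p (Suc j) x) * norm (p j x)) = a * b / k"
        using k by (simp add: a_def b_def power2_eq_square)
      also have "\<dots> = \<alpha> / 4 * (2 * a * b)" using \<alpha> by (simp add: k_def)
      also have "\<dots> \<le> \<alpha> / 4 * (u j + u (Suc j))"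
        using \<alpha> sum_squares_bound[of a b] unfolding u_def a_def b_def by (intro mult_left_mono) auto
      finally have "(k ^ j)\<^sup>2 * (norm (p (Suc j) x) * norm (p j x)) \<le> \<alpha> / 4 * (u j + u (Suc j))" .
      moreover have "(k ^ j)\<^sup>2 * (\<alpha> * (norm (p j x))\<^sup>2 - norm (p (Suc j) x) * norm (p j x))
          \<le> (k ^ j)\<^sup>2 * inner (p j (T x)) (p j x)"
        by (intro mult_left_mono T that) auto
      moreover have "(k ^ j)\<^sup>2 * (\<alpha> * (norm (p j x))\<^sup>2) = \<alpha> * u j"
        by (simp add: u_def power_mult_distrib)
      ultimately show ?thesis by (simp add: right_diff_distrib)
    qed
    then have "(\<Sum>j<m. \<alpha> * u j - \<alpha> / 4 * (u j + u (Suc j))) \<le> f (T x) x"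
      unfolding f_def by (intro sum_mono) auto
    moreover have "(\<Sum>j<m. \<alpha> * u j - \<alpha> / 4 * (u j + u (Suc j)))
        = \<alpha> * f x x - \<alpha> / 4 * (f x x + (\<Sum>j<m. u (Suc j)))"
      by (simp only: sum_subtractf sum.distrib u flip: sum_distrib_left)
    moreover have "\<alpha> / 4 * (f x x + (\<Sum>j<m. u (Suc j))) \<le> \<alpha> / 4 * (f x x + f x x)"
      using \<alpha> shift by (intro mult_left_mono) auto
    ultimately show ?thesis by simp
  qed
  ultimately show ?thesis unfolding lyapunov_form_def using \<alpha> half_gt_zero[OF \<alpha>] by blast
qed

lemma inner_scale_mat: "inner (c *\<^sub>m M) M = Re c * (norm M)\<^sup>2"
proof -
  have *: "inner (c * z) z = Re c * inner z z" for z
    by (simp add: inner_complex_def algebra_simps)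
  show ?thesis
    unfolding power2_norm_eq_inner by (simp add: inner_vec_def * sum_distrib_left)
qed

text \<open>The inner product on complex entries is real and sees only \<open>Re l\<close>; the
  other term is Cauchy-Schwarz. This is the point where positive real parts turn into
  coercivity.\<close>

lemma inner_bidiagonal_ge:
  assumes "\<alpha> \<le> Re l"
  shows "\<alpha> * (norm M)\<^sup>2 - norm N * norm M \<le> inner (l *\<^sub>m M + N) M"
  using norm_cauchy_schwarz[of "- N" M] mult_right_mono[OF assms, of "(norm M)\<^sup>2"]
  by (simp add: inner_add_left inner_scale_mat)

lemma positive_lower_bound:
  fixes l :: "nat \<Rightarrow> complex"
  assumes "\<And>j. j < m \<Longrightarrow> Re (l j) > 0"
  obtains \<alpha> where "\<alpha> > 0" "\<And>j. j < m \<Longrightarrow> \<alpha> \<le> Re (l j)"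
proof
  show "Min (insert 1 ((\<lambda>j. Re (l j)) ` {..<m})) > 0" using assms by auto
qed auto

lemma lyapunov_form_left:
  assumes "positive_stable (A::complex^'r^'r)"
  obtains f c where "lyapunov_form f (\<lambda>X::complex^'r^'r. A ** X) c"
proof -
  obtain m P l where P: "P 0 = mat 1" "P m = 0" "\<And>j. j < m \<Longrightarrow> Re (l j) > 0"
    "\<And>j. j < m \<Longrightarrow> P j ** A = l j *\<^sub>m P j + P (Suc j)"
    using annihilating_chain[OF assms] by metis
  obtain \<alpha> where \<alpha>: "\<alpha> > 0" "\<And>j. j < m \<Longrightarrow> \<alpha> \<le> Re (l j)"
    using positive_lower_bound[of m l] P(3) by blast
  have "\<exists>f c. lyapunov_form f (\<lambda>X::complex^'r^'r. A ** X) c"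
  proof (rule lyapunov_form_exists[where p = "\<lambda>j X. P j ** X" and m = m])
    show "linear (\<lambda>X::complex^'r^'r. P j ** X)" for j
      using mat_mult.bounded_linear_right bounded_linear.linear by blast
    show "\<alpha> * (norm (P j ** X))\<^sup>2 - norm (P (Suc j) ** X) * norm (P j ** X)
        \<le> inner (P j ** (A ** X)) (P j ** X)" if "j < m" for j and X :: "complex^'r^'r"
      using inner_bidiagonal_ge[OF \<alpha>(2)[OF that], of "P j ** X" "P (Suc j) ** X"] P(4)[OF that]
      by (simp add: matrix_mul_assoc matrix_mul_distrib)
  qed (use P \<alpha> in auto)
  then show ?thesis using that by blast
qed

text \<open>In the right-hand action \<open>A\<close> meets \<open>P j\<close> from the left, so the
  chain relation becomes available only after commuting \<open>A\<close> with
  \<open>P j\<close>.\<close>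

lemma lyapunov_form_right:
  assumes "positive_stable (A::complex^'r^'r)"
  obtains f c where "lyapunov_form f (\<lambda>X::complex^'r^'r. X ** A) c"
proof -
  obtain m P l where P: "P 0 = mat 1" "P m = 0" "\<And>j. j < m \<Longrightarrow> Re (l j) > 0"
    "\<And>j. j < m \<Longrightarrow> P j ** A = l j *\<^sub>m P j + P (Suc j)" "\<And>j. A ** P j = P j ** A"
    using annihilating_chain[OF assms] by metis
  obtain \<alpha> where \<alpha>: "\<alpha> > 0" "\<And>j. j < m \<Longrightarrow> \<alpha> \<le> Re (l j)"
    using positive_lower_bound[of m l] P(3) by blast
  have "\<exists>f c. lyapunov_form f (\<lambda>X::complex^'r^'r. X ** A) c"
  proof (rule lyapunov_form_exists[where p = "\<lambda>j X. X ** P j" and m = m])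
    show "linear (\<lambda>X::complex^'r^'r. X ** P j)" for j
      using mat_mult.bounded_linear_left bounded_linear.linear by blast
    show "\<alpha> * (norm (X ** P j))\<^sup>2 - norm (X ** P (Suc j)) * norm (X ** P j)
        \<le> inner ((X ** A) ** P j) (X ** P j)" if "j < m" for j and X :: "complex^'r^'r"
    proof -
      have "(X ** A) ** P j = l j *\<^sub>m (X ** P j) + X ** P (Suc j)"
        by (simp add: matrix_mul_assoc[symmetric] P(5) P(4)[OF that] matrix_mul_distrib)
      then show ?thesis
        using inner_bidiagonal_ge[OF \<alpha>(2)[OF that], of "X ** P j" "X ** P (Suc j)"] by simp
    qed
  qed (use P \<alpha> in auto)
  then show ?thesis using that by blast
qed

lemma lyapunov_form_has_derivative:
  assumes "lyapunov_form f T c" "(X has_vector_derivative X') (at s)"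
  shows "((\<lambda>s. f (X s) (X s)) has_real_derivative 2 * f X' (X s)) (at s)"
proof -
  interpret bounded_bilinear f by (rule lyapunov_formD[OF assms(1)])
  show ?thesis
    using has_vector_derivative[OF assms(2,2)] lyapunov_formD(2)[OF assms(1), of X' "X s"]
    by (simp add: has_real_derivative_iff_has_vector_derivative)
qed

text \<open>Along \<open>X' = - P X\<close> the energy \<open>E = f X X\<close> satisfies
  \<open>E' \<le> - 2 c E\<close>, so \<open>E t * exp (2 * c * t)\<close> does not increase; taking
  square roots leaves the rate \<open>c\<close>.\<close>

lemma mat_exp_decay:
  fixes P :: "complex^'r^'r"
  assumes "positive_stable P"
  obtains C \<delta> where "\<delta> > 0" "\<And>t. t \<ge> 0 \<Longrightarrow> norm (mat_exp (complex_of_real (- t) *\<^sub>m P)) \<le> C * exp (- \<delta> * t)"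
proof -
  obtain f c where f: "lyapunov_form f (\<lambda>X::complex^'r^'r. P ** X) c"
    by (rule lyapunov_form_left[OF assms])
  interpret bounded_bilinear f by (rule lyapunov_formD[OF f])
  define X where "X t = mat_exp (complex_of_real (- t) *\<^sub>m P)" for t
  define E where "E t = f (X t) (X t)" for t
  have dX: "(X has_vector_derivative (- (P ** X t))) (at t)" for t
  proof -
    have "((\<lambda>t. complex_of_real (- t)) has_vector_derivative of_real (- 1)) (at t)"
      by (intro has_vector_derivative_of_real derivative_intros)
    from mat_exp_has_vector_derivative[OF this, of P] show ?thesis
      by (simp add: X_def[abs_def])
  qed
  have dE: "((\<lambda>t. E t * exp (2 * c * t)) has_real_derivative
      (2 * f (- (P ** X t)) (X t) * exp (2 * c * t) + E t * (exp (2 * c * t) * (2 * c)))) (at t)" for t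
    unfolding E_def
    by (auto intro!: derivative_eq_intros lyapunov_form_has_derivative[OF f dX])
  have le: "E t * exp (2 * c * t) \<le> E 0" if "t \<ge> 0" for t
  proof -
    have "E t * exp (2 * c * t) \<le> E 0 * exp (2 * c * 0)"
    proof (rule DERIV_nonpos_imp_nonincreasing[OF that])
      fix x
      have "2 * exp (2 * c * x) * (c * E x - f (P ** X x) (X x)) \<le> 0"
        using lyapunov_formD(5)[OF f, of "X x"] by (intro mult_nonneg_nonpos) (auto simp: E_def)
      then have "2 * f (- (P ** X x)) (X x) * exp (2 * c * x) + E x * (exp (2 * c * x) * (2 * c)) \<le> 0"
        by (simp add: minus_left algebra_simps)
      with dE[of x] show "\<exists>y. ((\<lambda>t. E t * exp (2 * c * t)) has_real_derivative y) (at x) \<and> y \<le> 0"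
        by blast
    qed
    then show ?thesis by simp
  qed
  have E0: "E 0 \<ge> 0"
    unfolding E_def by (rule order_trans[OF zero_le_power2 lyapunov_formD(3)[OF f]])
  have "norm (X t) \<le> sqrt (E 0) * exp (- c * t)" if "t \<ge> 0" for t
  proof -
    have "(norm (X t))\<^sup>2 \<le> E t" unfolding E_def by (rule lyapunov_formD(3)[OF f])
    also have "E t = (E t * exp (2 * c * t)) * exp (- (2 * c * t))"
      by (simp add: exp_minus)
    also have "\<dots> \<le> E 0 * exp (- (2 * c * t))" using le[OF that] by (intro mult_right_mono) auto
    also have "\<dots> = (sqrt (E 0) * exp (- c * t))\<^sup>2"
      using E0 by (simp add: power_mult_distrib exp_double[symmetric] mult.assoc)
    finally show ?thesis
      by (rule power2_le_imp_le) (simp add: E0)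
  qed
  then show ?thesis using that[of c "sqrt (E 0)"] lyapunov_formD(4)[OF f] unfolding X_def by blast
qed

section \<open>Boundedness of the confluent function\<close>

text \<open>Completing the square. The weight \<open>\<epsilon>\<close> on \<open>b\<close> is kept
  small and the cost is moved to \<open>a\<close>, which in the applications is the norm of the
  strongly damped component \<open>q\<close>.\<close>

lemma young_inequality_scaled:
  fixes a b :: real
  assumes "\<epsilon> > 0"
  shows "2 * K * (a * b) \<le> \<epsilon> * b\<^sup>2 + K\<^sup>2 / \<epsilon> * a\<^sup>2"
proof -
  have "0 \<le> (\<epsilon> * b - K * a)\<^sup>2 / \<epsilon>" using assms by simp
  also have "\<dots> = \<epsilon> * b\<^sup>2 + K\<^sup>2 / \<epsilon> * a\<^sup>2 - 2 * K * (a * b)"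
    using assms by (simp add: field_simps power2_eq_square)
  finally show ?thesis by simp
qed

text \<open>The term \<open>- s q Y\<close> damps \<open>q\<close> arbitrarily strongly for large \<open>s\<close>, so the cross terms are
  absorbed and the total Lyapunov energy decreases.\<close>

lemma kummer_system_bounded:
  fixes g q g' q' r :: "nat \<Rightarrow> real \<Rightarrow> complex^'r^'r"
  assumes A: "positive_stable A" and Y: "positive_stable Y"
    and dg: "\<And>j s. j < m \<Longrightarrow> s > 0 \<Longrightarrow> (g j has_vector_derivative g' j s) (at s)"
    and dq: "\<And>j s. j < m \<Longrightarrow> s > 0 \<Longrightarrow> (q j has_vector_derivative q' j s) (at s)"
    and g': "\<And>j s. j < m \<Longrightarrow> s > 0 \<Longrightarrow> s *\<^sub>R g' j s = - (A ** g j s) - q j s"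
    and q': "\<And>j s. j < m \<Longrightarrow> s > 0 \<Longrightarrow> s *\<^sub>R q' j s = r j s - s *\<^sub>R (q j s ** Y)"
    and r: "\<And>j s. j < m \<Longrightarrow> s > 0 \<Longrightarrow>
      (norm (r j s))\<^sup>2 \<le> L * (\<Sum>i<m. (norm (g i s))\<^sup>2 + (norm (q i s))\<^sup>2)"
    and L: "L \<ge> 0"
  obtains s0 C where "s0 > 0" "\<And>j s. j < m \<Longrightarrow> s \<ge> s0 \<Longrightarrow> norm (g j s) \<le> C"
proof -
  obtain f1 c1 where f1: "lyapunov_form f1 (\<lambda>X::complex^'r^'r. A ** X) c1"
    by (rule lyapunov_form_left[OF A])
  obtain f2 c2 where f2: "lyapunov_form f2 (\<lambda>X::complex^'r^'r. X ** Y) c2"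
    by (rule lyapunov_form_right[OF Y])
  interpret f1: bounded_bilinear f1 by (rule lyapunov_formD[OF f1])
  interpret f2: bounded_bilinear f2 by (rule lyapunov_formD[OF f2])
  note c1 = lyapunov_formD(4)[OF f1] and c2 = lyapunov_formD(4)[OF f2]
  obtain K1 K2 where K1: "K1 > 0" "\<And>x y. norm (f1 x y) \<le> norm x * norm y * K1"
    and K2: "K2 > 0" "\<And>x y. norm (f2 x y) \<le> norm x * norm y * K2"
    using f1.pos_bounded f2.pos_bounded by blast
  \<comment> \<open>Chosen so that the \<open>m\<close> remainder terms together use at most the
    \<open>c1\<close> still left for \<open>g\<close>; the summand 1 keeps the denominator
    positive.\<close>
  define \<delta> where "\<delta> = c1 / (1 + real m * L)"
  have \<delta>: "\<delta> > 0" "\<delta> * (real m * L) \<le> c1"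
  proof -
    have "0 \<le> real m * L" using L by simp
    then show "\<delta> > 0" "\<delta> * (real m * L) \<le> c1" using c1 by (auto simp: \<delta>_def field_simps)
  qed
  \<comment> \<open>Beyond this point the damping \<open>2 * c2 * s\<close> outweighs everything
    charged to \<open>q\<close>: the coupling to \<open>g\<close>, the remainder, and the
    \<open>c1\<close> produced by absorbing the remainders. The maximum with 1 makes
    \<open>s0\<close> positive.\<close>
  define s0 where "s0 = max 1 ((K1\<^sup>2 / c1 + K2\<^sup>2 / \<delta> + c1) / (2 * c2))"
  have s0: "s0 > 0" by (simp add: s0_def)
  define E where "E s = (\<Sum>j<m. f1 (g j s) (g j s) + f2 (q j s) (q j s))" for s
  define E' where "E' s = (\<Sum>j<m. 2 * f1 (g' j s) (g j s) + 2 * f2 (q' j s) (q j s))" for s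
  have dE: "(E has_real_derivative E' s) (at s)" if "s > 0" for s
    unfolding E_def E'_def using that
    by (auto intro!: DERIV_sum DERIV_add lyapunov_form_has_derivative[OF f1]
        lyapunov_form_has_derivative[OF f2] dg dq)
  have E': "E' s \<le> 0" if s: "s \<ge> s0" for s
  proof -
    have s_pos: "s > 0" using s s0 by linarith
    define G Q where "G = (\<Sum>j<m. (norm (g j s))\<^sup>2)" and "Q = (\<Sum>j<m. (norm (q j s))\<^sup>2)"
    have Q: "Q \<ge> 0" by (auto simp: Q_def intro!: sum_nonneg)
    have G: "G \<ge> 0" by (auto simp: G_def intro!: sum_nonneg)
    \<comment> \<open>Coercivity of \<open>A\<close> gives \<open>- 2 * c1\<close> on
      \<open>g\<close>. One \<open>c1\<close> pays for the cross term between \<open>q\<close> and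
      \<open>g\<close>, and \<open>- c1\<close> remains; all other costs fall on \<open>q\<close>,
      where the damping grows with \<open>s\<close>.\<close>
    have "s * (2 * f1 (g' j s) (g j s) + 2 * f2 (q' j s) (q j s))
        \<le> - c1 * (norm (g j s))\<^sup>2 + (K1\<^sup>2 / c1 + K2\<^sup>2 / \<delta> - 2 * c2 * s) * (norm (q j s))\<^sup>2
          + \<delta> * (L * (G + Q))" (is "?l \<le> _") if j: "j < m" for j
    proof -
      have "?l = 2 * f1 (s *\<^sub>R g' j s) (g j s) + 2 * f2 (s *\<^sub>R q' j s) (q j s)"
        by (simp add: f1.scaleR_left f2.scaleR_left algebra_simps)
      also have "\<dots> = - 2 * f1 (A ** g j s) (g j s) - 2 * f1 (q j s) (g j s)
          + 2 * f2 (r j s) (q j s) - 2 * s * f2 (q j s ** Y) (q j s)"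
        using g'[OF j s_pos] q'[OF j s_pos]
        by (simp add: f1.diff_left f1.minus_left f2.diff_left f2.scaleR_left)
      finally have "?l = \<dots>" .
      moreover have "c1 * (norm (g j s))\<^sup>2 \<le> f1 (A ** g j s) (g j s)"
        using lyapunov_formD(5)[OF f1, of "g j s"] lyapunov_formD(3)[OF f1, of "g j s"] c1
        by (meson less_imp_le mult_left_mono order_trans)
      moreover have "s * (c2 * (norm (q j s))\<^sup>2) \<le> s * f2 (q j s ** Y) (q j s)"
        using lyapunov_formD(5)[OF f2, of "q j s"] lyapunov_formD(3)[OF f2, of "q j s"] c2 s_pos
        by (meson less_imp_le mult_left_mono order_trans)
      moreover have "- 2 * f1 (q j s) (g j s) \<le> c1 * (norm (g j s))\<^sup>2 + K1\<^sup>2 / c1 * (norm (q j s))\<^sup>2"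
        using K1(2)[of "q j s" "g j s"] young_inequality_scaled[OF c1, of K1 "norm (q j s)" "norm (g j s)"]
        by (simp add: mult_ac abs_le_iff)
      moreover have "2 * f2 (r j s) (q j s) \<le> \<delta> * (norm (r j s))\<^sup>2 + K2\<^sup>2 / \<delta> * (norm (q j s))\<^sup>2"
        using K2(2)[of "r j s" "q j s"] young_inequality_scaled[OF \<delta>(1), of K2 "norm (q j s)" "norm (r j s)"]
        by (simp add: mult_ac abs_le_iff)
      moreover have "\<delta> * (norm (r j s))\<^sup>2 \<le> \<delta> * (L * (G + Q))"
        using r[OF j s_pos] \<delta>(1) by (intro mult_left_mono) (auto simp: G_def Q_def sum.distrib)
      ultimately show ?thesis by (simp add: algebra_simps)
    qed
    then have "s * E' s \<le> (\<Sum>j<m. - c1 * (norm (g j s))\<^sup>2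
        + (K1\<^sup>2 / c1 + K2\<^sup>2 / \<delta> - 2 * c2 * s) * (norm (q j s))\<^sup>2 + \<delta> * (L * (G + Q)))"
      unfolding E'_def sum_distrib_left by (intro sum_mono) auto
    also have "\<dots> = - c1 * G + (K1\<^sup>2 / c1 + K2\<^sup>2 / \<delta> - 2 * c2 * s) * Q + \<delta> * (real m * L) * (G + Q)"
      unfolding sum.distrib sum_distrib_left[symmetric] G_def[symmetric] Q_def[symmetric]
      by (simp add: distrib_left)
    also have "\<dots> \<le> - c1 * G + (K1\<^sup>2 / c1 + K2\<^sup>2 / \<delta> - 2 * c2 * s) * Q + c1 * (G + Q)"
      using \<delta>(2) G Q by (intro add_left_mono mult_right_mono) auto
    also have "\<dots> = (K1\<^sup>2 / c1 + K2\<^sup>2 / \<delta> + c1 - 2 * c2 * s) * Q" by (simp add: algebra_simps)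
    also have "\<dots> \<le> 0"
    proof (rule mult_nonpos_nonneg[OF _ Q])
      have "(K1\<^sup>2 / c1 + K2\<^sup>2 / \<delta> + c1) / (2 * c2) \<le> s" using s by (simp add: s0_def)
      then show "K1\<^sup>2 / c1 + K2\<^sup>2 / \<delta> + c1 - 2 * c2 * s \<le> 0"
        using c2 by (simp add: pos_divide_le_eq mult_ac)
    qed
    finally show ?thesis using s_pos by (simp add: mult_le_0_iff)
  qed
  have "norm (g j s) \<le> sqrt (E s0)" if "j < m" "s \<ge> s0" for j s
  proof -
    have nonneg: "f1 x x \<ge> 0" "f2 x x \<ge> 0" for x
      using lyapunov_formD(3)[OF f1, of x] lyapunov_formD(3)[OF f2, of x] by (meson order_trans zero_le_power2)+
    have "(norm (g j s))\<^sup>2 \<le> f1 (g j s) (g j s) + f2 (q j s) (q j s)"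
      using lyapunov_formD(3)[OF f1, of "g j s"] nonneg(2)[of "q j s"] by linarith
    also have "\<dots> \<le> E s" unfolding E_def using that nonneg
      by (intro member_le_sum[of _ _ "\<lambda>j. f1 (g j s) (g j s) + f2 (q j s) (q j s)"]) auto
    also have "\<dots> \<le> E s0"
    proof (rule DERIV_nonpos_imp_nonincreasing[OF that(2)])
      fix x assume "s0 \<le> x"
      with dE[of x] E'[of x] s0 show "\<exists>y. (E has_real_derivative y) (at x) \<and> y \<le> 0"
        by (meson less_le_trans)
    qed
    finally show ?thesis by (rule real_le_rsqrt)
  qed
  with s0 show ?thesis by (rule that)
qed

text \<open>The coefficients of \<open>s \<mapsto> 1F1(A;B;-sY)\<close> with a matrix \<open>M\<close> inserted between the two Pochhammer
  symbols: multiplying \<open>M\<close> by \<open>B\<close> on the right takes over the role of the lower parameter in Kummer's equation,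
  although \<open>A\<close>, \<open>B\<close>, \<open>Y\<close> need not commute.\<close>

definition kummer_coeff ::
  "complex^'r^'r \<Rightarrow> complex^'r^'r \<Rightarrow> complex^'r^'r \<Rightarrow> complex^'r^'r \<Rightarrow> nat \<Rightarrow> complex^'r^'r" where
  "kummer_coeff A B Y M n = ((- 1) ^ n / fact n) *\<^sub>m
    (mat_pochhammer A n ** M ** matrix_inv (mat_pochhammer B n) ** mat_power Y n)"

lemma hyp1F1_mat_eq_mat_series:
  "hyp1F1_mat A B ((- c) *\<^sub>m Y) = mat_series (kummer_coeff A B Y (mat 1)) c"
  unfolding hyp1F1_mat_def mat_series_def kummer_coeff_def mat_power_scale power_minus[of c]
  by (simp add: mult_ac del: scale_mat_simps(4))

text \<open>The summand \<open>mat (of_nat n)\<close> acts as an exact scaling, so \<open>n\<close>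
  carries no factor from \<open>norm_matrix_mult_bound\<close>. A factor there would spoil the ratio
  limit 1 and with it the radius of the binomial series.\<close>

lemma norm_pochhammer_ratio:
  obtains a where "a \<ge> 0" "\<And>n. norm (mat_pochhammer (A::complex^'r^'r) (Suc n)) \<le> (a + real n) * norm (mat_pochhammer A n)"
proof -
  from norm_matrix_mult_bound[where 'r='r] obtain K where K: "K > 0"
    "\<forall>(M :: complex^'r^'r) (N :: complex^'r^'r). norm (M ** N) \<le> K * norm M * norm N"
    by (elim exE conjE)
  have "norm (mat_pochhammer A (Suc n)) \<le> (K * norm A + real n) * norm (mat_pochhammer A n)" for n
  proof -
    have "norm (mat_pochhammer A (Suc n)) = norm (mat_pochhammer A n ** A + of_nat n *\<^sub>m mat_pochhammer A n)"
      by (simp add: matrix_mul_distrib)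
    also have "\<dots> \<le> K * norm (mat_pochhammer A n) * norm A + real n * norm (mat_pochhammer A n)"
      using K(2) by (intro norm_triangle_mono) auto
    finally show ?thesis by (simp add: algebra_simps)
  qed
  then show ?thesis using that[of "K * norm A"] K(1) by simp
qed

text \<open>With \<open>D\<close> the next inverse, \<open>n D\<close> equals the previous inverse
  minus \<open>B ** D\<close>; for large \<open>n\<close> the last term is absorbed on the
  left.\<close>

lemma norm_matrix_inv_pochhammer_ratio:
  assumes "positive_stable (B::complex^'r^'r)"
  obtains b where "b \<ge> 0" "\<And>n. real n > b \<Longrightarrow> norm (matrix_inv (mat_pochhammer B (Suc n)))
      \<le> norm (matrix_inv (mat_pochhammer B n)) / (real n - b)"
proof -
  from norm_matrix_mult_bound[where 'r='r] obtain K where K: "K > 0"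
    "\<forall>(M :: complex^'r^'r) (N :: complex^'r^'r). norm (M ** N) \<le> K * norm M * norm N"
    by (elim exE conjE)
  show ?thesis
  proof (rule that[of "K * norm B"])
    fix n assume n: "real n > K * norm B"
    define D where "D = matrix_inv (mat_pochhammer B (Suc n))"
    have "of_nat n *\<^sub>m D = matrix_inv (mat_pochhammer B n) - B ** D"
      using matrix_inv_pochhammer_Suc[OF assms, of n] by (simp add: D_def matrix_mul_distrib algebra_simps)
    then have "real n * norm D = norm (matrix_inv (mat_pochhammer B n) - B ** D)"
      using norm_scale_mat[of "of_nat n" D] by simp
    also have "\<dots> \<le> norm (matrix_inv (mat_pochhammer B n)) + K * norm B * norm D"
      using K(2) by (meson add_left_mono norm_triangle_ineq4 order_trans)
    finally have "(real n - K * norm B) * norm D \<le> norm (matrix_inv (mat_pochhammer B n))"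
      by (simp add: algebra_simps)
    then show "norm D \<le> norm (matrix_inv (mat_pochhammer B n)) / (real n - K * norm B)"
      using n by (simp add: field_simps)
  qed (use K(1) in auto)
qed

lemma mat_conv_kummer_coeff:
  fixes B :: "complex^'r^'r"
  assumes "positive_stable B"
  shows "mat_conv (kummer_coeff A B Y M) R"
proof -
  from norm_matrix_mult_bound[where 'r='r] obtain K where K: "K > 0"
    "\<forall>(M :: complex^'r^'r) (N :: complex^'r^'r). norm (M ** N) \<le> K * norm M * norm N"
    by (elim exE conjE)
  obtain a where a: "a \<ge> 0"
    "\<And>n. norm (mat_pochhammer A (Suc n)) \<le> (a + real n) * norm (mat_pochhammer A n)"
    using norm_pochhammer_ratio[of A] by blast
  obtain b where b: "b \<ge> 0" "\<And>n. real n > b \<Longrightarrow> norm (matrix_inv (mat_pochhammer B (Suc n)))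
      \<le> norm (matrix_inv (mat_pochhammer B n)) / (real n - b)"
    using norm_matrix_inv_pochhammer_ratio[OF assms] by blast
  \<comment> \<open>The coefficients themselves obey no one-step norm bound, since new factors enter
    in the middle of the product. The product of the separate norms does, with ratio of order
    \<open>1 / n\<close>.\<close>
  define u where "u n = norm (mat_pochhammer A n) * norm (matrix_inv (mat_pochhammer B n))
    * norm (mat_power Y n) / fact n" for n
  define r where "r n = (a + real n) * (1 / (real n - b)) * (K * norm Y) / (real n + 1)" for n
  have "u (Suc n) \<le> r n * u n" if n: "real n > b" for n
  proof -
    have "u (Suc n) \<le> ((a + real n) * norm (mat_pochhammer A n))
        * (norm (matrix_inv (mat_pochhammer B n)) / (real n - b))
        * (K * norm (mat_power Y n) * norm Y) / fact (Suc n)"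
      unfolding u_def using a b n K by (intro divide_right_mono mult_mono) auto
    also have "\<dots> = r n * u n" by (simp add: r_def u_def mult_ac add.commute)
    finally show ?thesis .
  qed
  moreover have "\<forall>\<^sub>F n in sequentially. real n > b"
    using filterlim_real_sequentially by (simp add: filterlim_at_top_dense)
  ultimately have step: "\<forall>\<^sub>F n in sequentially. u (Suc n) \<le> r n * u n" by (auto elim: eventually_mono)
  have lim: "r \<longlonglongrightarrow> 0" unfolding r_def by real_asymp
  have bound: "norm (kummer_coeff A B Y M n) \<le> (K ^ 3 * norm M) * u n" for n
  proof -
    define P D W where "P = mat_pochhammer A n" and "D = matrix_inv (mat_pochhammer B n)" and "W = mat_power Y n"
    have "norm (P ** M ** D ** W) \<le> K * norm (P ** M ** D) * norm W" using K(2) by blast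
    also have "\<dots> \<le> K * (K * norm (P ** M) * norm D) * norm W"
      using K by (intro mult_right_mono mult_left_mono) auto
    also have "\<dots> \<le> K * (K * (K * norm P * norm M) * norm D) * norm W"
      using K by (intro mult_right_mono mult_left_mono) auto
    finally have "norm (P ** M ** D ** W) / fact n \<le> K * (K * (K * norm P * norm M) * norm D) * norm W / fact n"
      by (intro divide_right_mono) auto
    then show ?thesis
      by (simp add: kummer_coeff_def u_def norm_divide norm_power P_def D_def W_def power3_eq_cube mult_ac)
  qed
  show ?thesis
    unfolding mat_conv_def
  proof (intro allI impI)
    fix \<rho> :: real assume \<rho>: "0 \<le> \<rho>"
    have "summable (\<lambda>n. u n * \<rho> ^ n)"
      by (rule summable_ratio_limit[OF _ step lim \<rho>]) (auto simp: u_def)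
    then have "summable (\<lambda>n. (K ^ 3 * norm M) * (u n * \<rho> ^ n))" by (rule summable_mult)
    moreover have "norm (norm (kummer_coeff A B Y M n) * \<rho> ^ n) \<le> (K ^ 3 * norm M) * (u n * \<rho> ^ n)" for n
      using mult_right_mono[OF bound[of n], of "\<rho> ^ n"] \<rho> by (simp add: mult.assoc)
    ultimately show "summable (\<lambda>n. norm (kummer_coeff A B Y M n) * \<rho> ^ n)"
      by (rule summable_comparison_test'[where N = 0])
  qed
qed

text \<open>The combination has the shape of the chain relation, so the function at
  \<open>P j ** B\<close> splits into those at \<open>P j\<close> and
  \<open>P (Suc j)\<close>.\<close>

lemma kummer_coeff_linear:
  "kummer_coeff A B Y (c *\<^sub>m M + N) n = c *\<^sub>m kummer_coeff A B Y M n + kummer_coeff A B Y N n"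
  unfolding kummer_coeff_def by (simp add: matrix_mul_distrib scale_mat_distrib mult_ac)

lemma kummer_coeff_0: "kummer_coeff A B Y 0 n = 0"
  by (simp add: kummer_coeff_def)

text \<open>Kummer's equation at the level of coefficients: \<open>A + n\<close> commutes with the
  upper symbol and raises its index, while the inverse lower symbol is rewritten at
  \<open>Suc n\<close>. This creates a factor \<open>B\<close> directly to the right of
  \<open>M\<close>.\<close>

lemma kummer_coeff_recurrence:
  assumes "positive_stable B"
  shows "(A ** kummer_coeff A B Y M n + of_nat n *\<^sub>m kummer_coeff A B Y M n) ** Y
    = - (of_nat (Suc n) *\<^sub>m (kummer_coeff A B Y (M ** B) (Suc n) + of_nat n *\<^sub>m kummer_coeff A B Y M (Suc n)))"
proof -
  define D where "D = matrix_inv (mat_pochhammer B (Suc n))"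
  define P where "P = mat_pochhammer A (Suc n)"
  have P: "A ** mat_pochhammer A n + of_nat n *\<^sub>m mat_pochhammer A n = P"
    using mat_pochhammer_commute[of A A n] by (simp add: P_def matrix_mul_distrib)
  have D: "B ** D + of_nat n *\<^sub>m D = matrix_inv (mat_pochhammer B n)"
    using matrix_inv_pochhammer_Suc[OF assms, of n] by (simp add: D_def matrix_mul_distrib)
  have "(A ** kummer_coeff A B Y M n + of_nat n *\<^sub>m kummer_coeff A B Y M n) ** Y
      = ((- 1) ^ n / fact n) *\<^sub>m ((A ** mat_pochhammer A n + of_nat n *\<^sub>m mat_pochhammer A n)
        ** M ** (B ** D + of_nat n *\<^sub>m D) ** mat_power Y (Suc n))"
    by (simp add: kummer_coeff_def D matrix_mul_distrib scale_mat_distrib matrix_mul_assoc mult_ac)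
  also have "\<dots> = ((- 1) ^ n / fact n) *\<^sub>m (P ** (M ** B) ** D ** mat_power Y (Suc n)
      + of_nat n *\<^sub>m (P ** M ** D ** mat_power Y (Suc n)))"
    unfolding P by (simp add: matrix_mul_distrib matrix_mul_assoc)
  also have "((- 1) ^ n / fact n :: complex) = - (of_nat (Suc n) * ((- 1) ^ Suc n / fact (Suc n)))"
    by (simp del: of_nat_Suc)
  finally show ?thesis
    unfolding kummer_coeff_def P_def[symmetric] D_def[symmetric]
    by (simp add: scale_mat_distrib mult_ac del: mat_power.simps of_nat_Suc fact_Suc power_Suc)
qed

lemma mat_series_shift:
  assumes "mat_conv h R" "norm c < R" "e 0 = 0" "\<And>n. e (Suc n) = h n"
  shows "mat_series e c = c *\<^sub>m mat_series h c"
proof -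
  have "(\<lambda>n. c *\<^sub>m (c ^ n *\<^sub>m h n)) sums (c *\<^sub>m mat_series h c)"
    unfolding mat_series_def
    using bounded_linear.sums[OF mat_scale.bounded_linear_right summable_sums[OF summable_mat_series[OF assms(1,2)]]] .
  then have "(\<lambda>n. c ^ Suc n *\<^sub>m e (Suc n)) sums (c *\<^sub>m mat_series h c)"
    by (simp add: assms(4))
  then have "(\<lambda>n. c ^ n *\<^sub>m e n) sums (c *\<^sub>m mat_series h c)"
    by (subst (asm) sums_Suc_iff) (simp add: assms(3))
  then show ?thesis unfolding mat_series_def by (rule sums_unique[symmetric])
qed

definition kummer_fun ::
  "complex^'r^'r \<Rightarrow> complex^'r^'r \<Rightarrow> complex^'r^'r \<Rightarrow> complex^'r^'r \<Rightarrow> real \<Rightarrow> complex^'r^'r" where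
  "kummer_fun A B Y M s = mat_series (kummer_coeff A B Y M) (complex_of_real s)"

text \<open>With \<open>g = kummer_fun A B Y M\<close> this is \<open>- s g' - A g\<close>, which turns Kummer's equation into a
  first-order system.\<close>

definition kummer_flux ::
  "complex^'r^'r \<Rightarrow> complex^'r^'r \<Rightarrow> complex^'r^'r \<Rightarrow> complex^'r^'r \<Rightarrow> real \<Rightarrow> complex^'r^'r" where
  "kummer_flux A B Y M s = mat_series
    (\<lambda>n. - (A ** kummer_coeff A B Y M n + of_nat n *\<^sub>m kummer_coeff A B Y M n)) (complex_of_real s)"

text \<open>The operator \<open>s d/ds\<close> multiplies the coefficient of index \<open>n\<close>
  by \<open>n\<close>, so each identity reduces to one between coefficients. Keeping
  \<open>s\<close> on the left avoids division at \<open>s = 0\<close>.\<close>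

lemma kummer_system:
  fixes A B Y :: "complex^'r^'r"
  assumes B: "positive_stable B"
  defines "g \<equiv> kummer_fun A B Y" and "q \<equiv> kummer_flux A B Y"
  shows "\<exists>g'. (g M has_vector_derivative g') (at s) \<and> s *\<^sub>R g' = - (A ** g M s) - q M s"
    and "\<exists>q'. (q M has_vector_derivative q') (at s) \<and>
      s *\<^sub>R q' = (q M s + A ** g M s) + A ** (q M s + A ** g M s)
        - (q (M ** B) s + A ** g (M ** B) s) - s *\<^sub>R (q M s ** Y)"
    and "g (c *\<^sub>m M + N) s = c *\<^sub>m g M s + g N s"
    and "q (c *\<^sub>m M + N) s = c *\<^sub>m q M s + q N s"
    and "g 0 s = 0" "q 0 s = 0"
proof -
  define C where "C = kummer_coeff A B Y"
  define Q where "Q M n = - (A ** C M n + of_nat n *\<^sub>m C M n)" for M n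
  have g_eq: "g M s = mat_series (C M) (complex_of_real s)" for M s by (simp add: g_def kummer_fun_def C_def)
  have q_eq: "q M s = mat_series (Q M) (complex_of_real s)" for M s
    by (simp add: q_def kummer_flux_def Q_def[abs_def] C_def)
  note ops = mat_conv_add mat_conv_scale mat_conv_mult_left mat_conv_mult_right mat_conv_uminus
    mat_conv_of_nat
  have conv: "mat_conv (C M) R" for M R unfolding C_def by (rule mat_conv_kummer_coeff[OF B])
  have convQ: "mat_conv (Q M) R" for M R unfolding Q_def by (intro ops conv)
  have small: "norm (complex_of_real s) < \<bar>s\<bar> + 1" for s by simp
  note ser = mat_series_add[OF _ _ small] mat_series_scale[OF _ small] mat_series_mult_left[OF _ small]
    mat_series_mult_right[OF _ small] mat_series_uminus[OF _ small]
  have theta: "mat_series (\<lambda>n. of_nat n *\<^sub>m C M n) (complex_of_real s) = - (A ** g M s) - q M s" for M s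
    unfolding q_eq g_eq Q_def[abs_def] by (simp only: ser ops conv) simp
  \<comment> \<open>The combination \<open>q + A g\<close> is \<open>- s g'\<close>, so these terms
    are linear in the unknowns with coefficients independent of \<open>s\<close>.\<close>
  have p: "mat_series (\<lambda>n. - (of_nat n *\<^sub>m C M n)) (complex_of_real s) = q M s + A ** g M s" for M s
    by (simp add: ser ops conv theta)
  have lin: "C (c *\<^sub>m M + N) = (\<lambda>n. c *\<^sub>m C M n + C N n)" for c M N
    by (rule ext) (simp add: C_def kummer_coeff_linear)
  have Qlin: "Q (c *\<^sub>m M + N) = (\<lambda>n. c *\<^sub>m Q M n + Q N n)" for c M N
    by (rule ext) (simp add: Q_def lin scale_mat_distrib matrix_mul_distrib mult_ac)
  have "(g M has_vector_derivative mat_series (mat_diffs (C M)) (complex_of_real s)) (at s)"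
    unfolding g_eq[abs_def] by (rule mat_series_has_vector_derivative_of_real[OF conv])
  moreover have "s *\<^sub>R mat_series (mat_diffs (C M)) (complex_of_real s) = - (A ** g M s) - q M s"
    using mat_series_diffs_mult[OF conv small] theta by (simp add: scale_mat_scaleR)
  ultimately show "\<exists>g'. (g M has_vector_derivative g') (at s) \<and> s *\<^sub>R g' = - (A ** g M s) - q M s"
    by blast
  have "(q M has_vector_derivative mat_series (mat_diffs (Q M)) (complex_of_real s)) (at s)"
    unfolding q_eq[abs_def] by (rule mat_series_has_vector_derivative_of_real[OF convQ])
  moreover have "s *\<^sub>R mat_series (mat_diffs (Q M)) (complex_of_real s)
      = (q M s + A ** g M s) + A ** (q M s + A ** g M s)
      - (q (M ** B) s + A ** g (M ** B) s) - s *\<^sub>R (q M s ** Y)"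
  proof -
    \<comment> \<open>The series of \<open>s q'\<close> minus its terms without the factor
      \<open>s\<close>. By the recurrence its coefficients are those of \<open>- q Y\<close> moved
      up by one index, which is multiplication by \<open>s\<close>.\<close>
    define e where "e n = of_nat n *\<^sub>m Q M n
      + - (- (of_nat n *\<^sub>m C M n) + A ** (- (of_nat n *\<^sub>m C M n)) + - (- (of_nat n *\<^sub>m C (M ** B) n)))" for n
    have "e (Suc n) = - (Q M n ** Y)" for n
    proof -
      have "e (Suc n) = - (of_nat (Suc n) *\<^sub>m (C (M ** B) (Suc n) + of_nat n *\<^sub>m C M (Suc n)))"
        by (simp add: e_def Q_def scale_mat_distrib matrix_mul_distrib algebra_simps)
      also have "\<dots> = - (Q M n ** Y)"
        using kummer_coeff_recurrence[OF B, of A Y M n] by (simp add: Q_def C_def matrix_mul_distrib add.commute)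
      finally show ?thesis .
    qed
    moreover have "e 0 = 0" by (simp add: e_def)
    ultimately have "mat_series e (complex_of_real s)
        = complex_of_real s *\<^sub>m mat_series (\<lambda>n. - (Q M n ** Y)) (complex_of_real s)"
      by (intro mat_series_shift[OF _ small] ops convQ) auto
    also have "\<dots> = - (s *\<^sub>R (q M s ** Y))"
      by (simp add: ser ops convQ q_eq scale_mat_scaleR)
    finally have "mat_series e (complex_of_real s) = - (s *\<^sub>R (q M s ** Y))" .
    moreover have "mat_series e (complex_of_real s) = mat_series (\<lambda>n. of_nat n *\<^sub>m Q M n) (complex_of_real s)
        - ((q M s + A ** g M s) + A ** (q M s + A ** g M s) - (q (M ** B) s + A ** g (M ** B) s))"
      unfolding e_def[abs_def]
      by (simp only: ser ops conv convQ p) simp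
    ultimately show ?thesis
      using mat_series_diffs_mult[OF convQ small] by (simp add: scale_mat_scaleR algebra_simps)
  qed
  ultimately show "\<exists>q'. (q M has_vector_derivative q') (at s) \<and>
      s *\<^sub>R q' = (q M s + A ** g M s) + A ** (q M s + A ** g M s)
        - (q (M ** B) s + A ** g (M ** B) s) - s *\<^sub>R (q M s ** Y)"
    by blast
  show "g (c *\<^sub>m M + N) s = c *\<^sub>m g M s + g N s"
    by (simp add: g_eq lin ser ops conv)
  show "q (c *\<^sub>m M + N) s = c *\<^sub>m q M s + q N s"
    by (simp add: q_eq Qlin ser ops convQ)
  show "g 0 s = 0" "q 0 s = 0"
    by (simp_all add: g_def q_def kummer_fun_def kummer_flux_def kummer_coeff_0 mat_series_def)
qed

lemma continuous_on_hyp1F1_mat: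
  assumes "positive_stable B" "continuous_on S f"
  shows "continuous_on S (\<lambda>t. hyp1F1_mat A B (complex_of_real (- f t) *\<^sub>m Y))"
proof -
  have "isCont (kummer_fun A B Y (mat 1)) s" for s
    using kummer_system(1)[OF assms(1), of A Y "mat 1" s] has_vector_derivative_continuous by blast
  then have "continuous_on UNIV (kummer_fun A B Y (mat 1))"
    by (simp add: continuous_on_eq_continuous_at)
  from continuous_on_compose2[OF this assms(2)]
  have "continuous_on S (\<lambda>t. kummer_fun A B Y (mat 1) (f t))" by simp
  then show ?thesis
    using hyp1F1_mat_eq_mat_series[of A B "complex_of_real _" Y] by (simp add: kummer_fun_def)
qed

text \<open>The energy estimate is applied to the functions with inserted matrices
  \<open>P 0\<close>, ..., \<open>P (m - 1)\<close> of a chain for \<open>B\<close>; the member at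
  \<open>P 0 = mat 1\<close> is the 1F1 in question. Below \<open>s0\<close> continuity on a compact
  interval suffices.\<close>

lemma hyp1F1_mat_bounded:
  fixes A B Y :: "complex^'r^'r"
  assumes stable: "positive_stable A" "positive_stable B" "positive_stable Y"
  obtains C where "\<And>s. s \<ge> 0 \<Longrightarrow> norm (hyp1F1_mat A B (complex_of_real (- s) *\<^sub>m Y)) \<le> C"
proof -
  define g where "g = kummer_fun A B Y"
  define q where "q = kummer_flux A B Y"
  note kummer_sys = kummer_system[OF stable(2), of A Y, folded g_def q_def]
  obtain g' where dg: "(g M has_vector_derivative g' M s) (at s)"
    "s *\<^sub>R g' M s = - (A ** g M s) - q M s" for M s
    using kummer_sys(1) by metis
  obtain q' where dq: "(q M has_vector_derivative q' M s) (at s)"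
    "s *\<^sub>R q' M s = (q M s + A ** g M s) + A ** (q M s + A ** g M s)
      - (q (M ** B) s + A ** g (M ** B) s) - s *\<^sub>R (q M s ** Y)" for M s
    using kummer_sys(2) by metis
  obtain m P l where P: "P 0 = mat 1" "P m = 0"
    "\<And>j. j < m \<Longrightarrow> P j ** B = l j *\<^sub>m P j + P (Suc j)"
    using annihilating_chain[OF stable(2)] by metis
  from norm_matrix_mult_bound[where 'r='r] obtain K where K: "K > 0"
    "\<forall>(M :: complex^'r^'r) (N :: complex^'r^'r). norm (M ** N) \<le> K * norm M * norm N"
    by (elim exE conjE)
  \<comment> \<open>\<open>p j s\<close> is \<open>- s g'\<close> for the insertion
    \<open>P j\<close>. Below, \<open>r j\<close> gathers all of \<open>s q'\<close> except the
    damping, with \<open>P j ** B\<close> resolved by the chain relation.\<close>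
  define p where "p j s = q (P j) s + A ** g (P j) s" for j s
  define r where "r j s = p j s + A ** p j s - (l j *\<^sub>m p j s + p (Suc j) s)" for j s
  define N where "N s = (\<Sum>i<m. (norm (g (P i) s))\<^sup>2 + (norm (q (P i) s))\<^sup>2)" for s
  define a where "a = K * norm A"
  define b where "b = (\<Sum>i<m. norm (l i))"
  have a: "a \<ge> 0" using K(1) by (simp add: a_def)
  have KA: "norm (A ** X) \<le> a * norm X" for X :: "complex^'r^'r" using K(2) by (simp add: a_def)
  have N0: "N s \<ge> 0" for s by (auto simp: N_def intro!: sum_nonneg)
  have comp: "norm (g (P j) s) \<le> sqrt (N s)" "norm (q (P j) s) \<le> sqrt (N s)" if "j \<le> m" for j s
  proof -
    have "(norm (g (P j) s))\<^sup>2 + (norm (q (P j) s))\<^sup>2 \<le> N s"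
    proof (cases "j = m")
      case True
      then show ?thesis using P(2) kummer_sys(5,6) N0 by simp
    next
      case False
      then show ?thesis unfolding N_def using that
        by (intro member_le_sum[of _ _ "\<lambda>i. (norm (g (P i) s))\<^sup>2 + (norm (q (P i) s))\<^sup>2"]) auto
    qed
    then have le: "(norm (g (P j) s))\<^sup>2 \<le> N s" "(norm (q (P j) s))\<^sup>2 \<le> N s"
      using zero_le_power2[of "norm (g (P j) s)"] zero_le_power2[of "norm (q (P j) s)"] by linarith+
    from real_le_rsqrt[OF le(1)] real_le_rsqrt[OF le(2)]
    show "norm (g (P j) s) \<le> sqrt (N s)" "norm (q (P j) s) \<le> sqrt (N s)" .
  qed
  have p: "norm (p j s) \<le> (1 + a) * sqrt (N s)" if "j \<le> m" for j s
  proof -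
    have "norm (p j s) \<le> norm (q (P j) s) + a * norm (g (P j) s)"
      unfolding p_def using KA norm_triangle_ineq by (meson add_left_mono order_trans)
    also have "\<dots> \<le> sqrt (N s) + a * sqrt (N s)"
      using comp[OF that] a by (intro add_mono mult_left_mono) auto
    finally show ?thesis by (simp add: algebra_simps)
  qed
  have r: "norm (r j s) \<le> ((2 + a + b) * (1 + a)) * sqrt (N s)" if j: "j < m" for j s
  proof -
    have "norm (l j) \<le> b" unfolding b_def using j by (intro member_le_sum) auto
    then have "norm (l j *\<^sub>m p j s) \<le> b * norm (p j s)" by (auto intro: mult_right_mono)
    moreover have "norm (r j s) \<le> (norm (p j s) + norm (A ** p j s)) + (norm (l j *\<^sub>m p j s) + norm (p (Suc j) s))"
      unfolding r_def by (intro norm_triangle_le_diff add_mono norm_triangle_ineq)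
    ultimately have "norm (r j s) \<le> (1 + a + b) * norm (p j s) + norm (p (Suc j) s)"
      using KA[of "p j s"] by (simp add: algebra_simps)
    also have "\<dots> \<le> (1 + a + b) * ((1 + a) * sqrt (N s)) + (1 + a) * sqrt (N s)"
      using p[of j s] p[of "Suc j" s] j a by (intro add_mono mult_left_mono) (auto simp: b_def intro!: add_nonneg_nonneg sum_nonneg)
    finally show ?thesis by (simp add: algebra_simps)
  qed
  define L where "L = ((2 + a + b) * (1 + a))\<^sup>2"
  obtain s0 C where s0: "s0 > 0" "\<And>j s. j < m \<Longrightarrow> s \<ge> s0 \<Longrightarrow> norm (g (P j) s) \<le> C"
  proof (rule kummer_system_bounded[of A Y m "\<lambda>j. g (P j)" "\<lambda>j. g' (P j)" "\<lambda>j. q (P j)" "\<lambda>j. q' (P j)" r L])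
    show "s *\<^sub>R q' (P j) s = r j s - s *\<^sub>R (q (P j) s ** Y)" if "j < m" for j s
      unfolding dq(2) P(3)[OF that] kummer_sys(3,4) r_def p_def
      by (simp add: matrix_mul_distrib scale_mat_distrib algebra_simps)
    show "(norm (r j s))\<^sup>2 \<le> L * (\<Sum>i<m. (norm (g (P i) s))\<^sup>2 + (norm (q (P i) s))\<^sup>2)" if "j < m" for j s
      using power_mono[OF r[OF that, of s], of 2] N0[of s]
      by (simp add: L_def power_mult_distrib flip: N_def)
  qed (use stable dg dq in \<open>auto simp: L_def\<close>)
  have large: "norm (g (mat 1) s) \<le> max C 0" if "s \<ge> s0" for s
  proof (cases "m = 0")
    case True
    then have "(mat 1 :: complex^'r^'r) = 0" using P by simp
    then show ?thesis using kummer_sys(5) by simp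
  next
    case False
    then show ?thesis using s0(2)[of 0 s] that P(1) by (simp add: le_max_iff_disj)
  qed
  have "continuous_on {0..s0} (g (mat 1))"
    using has_vector_derivative_continuous[OF dg(1)] by (intro continuous_at_imp_continuous_on) blast
  then have "bounded (g (mat 1) ` {0..s0})"
    by (intro compact_imp_bounded compact_continuous_image) auto
  then obtain C' where C': "\<And>s. s \<in> {0..s0} \<Longrightarrow> norm (g (mat 1) s) \<le> C'"
    unfolding bounded_iff by blast
  have "norm (g (mat 1) s) \<le> max C' (max C 0)" if "s \<ge> 0" for s
    using large[of s] C'[of s] that by (cases "s \<ge> s0") (auto simp: le_max_iff_disj)
  then have "norm (hyp1F1_mat A B (complex_of_real (- s) *\<^sub>m Y)) \<le> max C' (max C 0)" if "s \<ge> 0" for s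
    using that hyp1F1_mat_eq_mat_series[of A B "complex_of_real s" Y] by (simp add: g_def kummer_fun_def)
  then show ?thesis by (rule that)
qed

section \<open>Euler integral representation\<close>

lemma mat_conv_pochhammer: "mat_conv (\<lambda>n. (1 / fact n) *\<^sub>m mat_pochhammer (A::complex^'r^'r) n) 1"
  unfolding mat_conv_def
proof (intro allI impI)
  obtain a where a: "a \<ge> 0"
    "\<And>n. norm (mat_pochhammer A (Suc n)) \<le> (a + real n) * norm (mat_pochhammer A n)"
    using norm_pochhammer_ratio[of A] by blast
  fix \<rho> :: real assume \<rho>: "0 \<le> \<rho>" "\<rho> < 1"
  show "summable (\<lambda>n. norm ((1 / fact n) *\<^sub>m mat_pochhammer A n) * \<rho> ^ n)"
  proof (rule summable_ratio_limit[where q = 1])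
    show "(\<lambda>n. (a + real n) / (real n + 1)) \<longlonglongrightarrow> 1" by real_asymp
    show "\<forall>\<^sub>F n in sequentially. norm ((1 / fact (Suc n)) *\<^sub>m mat_pochhammer A (Suc n))
        \<le> (a + real n) / (real n + 1) * norm ((1 / fact n) *\<^sub>m mat_pochhammer A n)"
    proof (rule always_eventually, rule allI)
      fix n
      have "norm (mat_pochhammer A (Suc n)) / fact (Suc n) \<le> ((a + real n) * norm (mat_pochhammer A n)) / fact (Suc n)"
        using a(2)[of n] by (intro divide_right_mono) auto
      then show "norm ((1 / fact (Suc n)) *\<^sub>m mat_pochhammer A (Suc n))
        \<le> (a + real n) / (real n + 1) * norm ((1 / fact n) *\<^sub>m mat_pochhammer A n)"
        unfolding norm_fact_scale by (simp add: mult_ac add.commute)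
    qed
  qed (use \<rho> in auto)
qed

text \<open>The recurrence of the Pochhammer symbols says that the sum \<open>S\<close> satisfies
  \<open>(1 - v) S' = S A\<close>. Uniqueness for this linear equation along the segment from 0 to
  \<open>w\<close> identifies it with the matrix power.\<close>

lemma mat_binomial_series:
  assumes w: "norm w < 1"
  shows "mat_series (\<lambda>n. (1 / fact n) *\<^sub>m mat_pochhammer A n) w = mat_cpow (1 - w) (- A)"
proof -
  define c where "c n = (1 / fact n) *\<^sub>m mat_pochhammer A n" for n
  have conv: "mat_conv c 1" unfolding c_def by (rule mat_conv_pochhammer)
  have ode: "(1 - v) *\<^sub>m mat_series (mat_diffs c) v = mat_series c v ** A" if v: "norm v < 1" for v
  proof -
    have "mat_diffs c = (\<lambda>n. c n ** A + of_nat n *\<^sub>m c n)"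
      by (rule ext) (simp add: mat_diffs_def c_def matrix_mul_distrib scale_mat_distrib mult_ac del: of_nat_Suc)
    then have "mat_series (mat_diffs c) v = mat_series c v ** A + mat_series (\<lambda>n. of_nat n *\<^sub>m c n) v"
      using mat_series_add[OF mat_conv_mult_right[OF conv] mat_conv_of_nat[OF conv] v]
        mat_series_mult_right[OF conv v] by simp
    moreover have "(1 - v) *\<^sub>m mat_series (mat_diffs c) v
        = mat_series (mat_diffs c) v - mat_series (\<lambda>n. of_nat n *\<^sub>m c n) v"
      by (simp only: scale_mat_distrib(4) scale_mat_simps(2) mat_series_diffs_mult[OF conv v])
    ultimately show ?thesis by simp
  qed
  define X where "X x = mat_series c (complex_of_real x * w)" for x
  have small: "norm (complex_of_real x * w) < 1" if "x \<in> {0..1}" for x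
    using that w mult_le_one[of x "norm w"] by (auto simp: norm_mult intro: le_less_trans[OF mult_left_le_one_le])
  \<comment> \<open>Along the segment, \<open>1 - x * w\<close> has positive real part, so
    \<open>- Ln\<close> of it is differentiable there and is the required primitive of
    \<open>w / (1 - x * w)\<close>.\<close>
  have "X 1 = X 0 ** mat_exp (- Ln (1 - complex_of_real 1 * w) *\<^sub>m A)"
  proof (rule mat_linear_ode_unique)
    fix x :: real assume x: "x \<in> {0..1}"
    define v where "v = complex_of_real x * w"
    have v: "norm v < 1" using small[OF x] by (simp add: v_def)
    then have "Re v < 1" using complex_Re_le_cmod[of v] by linarith
    then have v1: "v \<noteq> 1" "1 - v \<notin> \<real>\<^sub>\<le>\<^sub>0" by (auto simp: complex_nonpos_Reals_iff)
    have "(w / (1 - v)) *\<^sub>m (X x ** A) = (w / (1 - v)) *\<^sub>m ((1 - v) *\<^sub>m mat_series (mat_diffs c) v)"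
      using ode[OF v] by (simp add: X_def v_def)
    also have "\<dots> = w *\<^sub>m mat_series (mat_diffs c) v" using v1 by simp
    finally show "(X has_vector_derivative (w / (1 - complex_of_real x * w)) *\<^sub>m (X x ** A)) (at x within {0..1})"
      using mat_series_has_vector_derivative[OF conv small[OF x] has_vector_derivative_of_real_mult]
      by (simp add: X_def[abs_def] v_def)
    have "((\<lambda>v. - Ln (1 - v * w)) has_field_derivative (w / (1 - complex_of_real x * w))) (at (complex_of_real x))"
      using v1 by (auto intro!: derivative_eq_intros simp: v_def divide_inverse mult.commute)
    then show "((\<lambda>x. - Ln (1 - complex_of_real x * w)) has_vector_derivative (w / (1 - complex_of_real x * w)))
        (at x within {0..1})"
      by (rule has_vector_derivative_real_field)
  qed simp
  moreover have "X 0 = mat 1" by (simp add: X_def c_def)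
  ultimately show ?thesis by (simp add: X_def c_def[abs_def] mat_cpow_def)
qed

lemma diff_mat_eq_add: "M - mat c = M + mat (- c)" for M :: "complex^'r^'r"
  by (auto intro!: mat_eqI simp: mat_def)

lemma mat_cpow_add_nat:
  assumes "t > 0"
  shows "mat_cpow (complex_of_real t) (P + mat (of_nat n) - mat 1)
    = complex_of_real t ^ n *\<^sub>m mat_cpow (complex_of_real t) (P - mat 1)"
proof -
  have eq: "P + mat (of_nat n) - mat 1 = (P - mat 1) + mat (of_nat n)" by simp
  show ?thesis
    unfolding mat_cpow_def eq
    using mat_exp_add_mat[of "Ln (complex_of_real t)" "P - mat 1" "of_nat n"] assms
    by (simp add: exp_of_nat2_mult)
qed

text \<open>Taken at the nonnegative time \<open>- ln t\<close>, exponential decay becomes a factor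
  \<open>t powr \<delta>\<close>; subtracting the identity from \<open>P\<close> contributes
  \<open>1 / t\<close>.\<close>

lemma mat_cpow_bound:
  fixes P :: "complex^'r^'r"
  assumes "positive_stable P"
  shows "\<exists>C \<delta>. \<delta> > 0 \<and> C \<ge> 0 \<and>
    (\<forall>t\<in>{0<..<1}. norm (mat_cpow (complex_of_real t) (P - mat 1)) \<le> C * t powr (\<delta> - 1))"
proof -
  obtain C \<delta> where C: "\<delta> > 0"
    "\<And>t. t \<ge> 0 \<Longrightarrow> norm (mat_exp (complex_of_real (- t) *\<^sub>m P)) \<le> C * exp (- \<delta> * t)"
    using mat_exp_decay[OF assms] by blast
  have "norm (mat_cpow (complex_of_real t) (P - mat 1)) \<le> C * t powr (\<delta> - 1)" if "t \<in> {0<..<1}" for t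
  proof -
    have t: "0 < t" "t < 1" using that by auto
    have "norm (mat_cpow (complex_of_real t) (P - mat 1)) = exp (- ln t) * norm (mat_exp (complex_of_real (ln t) *\<^sub>m P))"
      using t mat_exp_add_mat[of "complex_of_real (ln t)" P "- 1"]
      by (simp add: mat_cpow_def diff_mat_eq_add Ln_of_real norm_exp_eq_Re)
    also have "\<dots> \<le> exp (- ln t) * (C * exp (\<delta> * ln t))"
      using C(2)[of "- ln t"] t by (intro mult_left_mono) auto
    also have "\<dots> = C * t powr (\<delta> - 1)"
      using t by (simp add: powr_def left_diff_distrib exp_diff exp_minus field_simps)
    finally show ?thesis .
  qed
  moreover have "C \<ge> 0" using order_trans[OF norm_ge_zero C(2)[of 0]] by simp
  ultimately show ?thesis using C(1) by blast
qed

definition euler_kernel ::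
  "complex^'r^'r \<Rightarrow> complex^'r^'r \<Rightarrow> complex^'r^'r \<Rightarrow> complex^'r^'r \<Rightarrow> complex^'r^'r \<Rightarrow> real \<Rightarrow> complex^'r^'r" where
  "euler_kernel A B Y P Q t =
    hyp1F1_mat A B (complex_of_real (- (1 / (t * (1 - t)))) *\<^sub>m Y)
      ** mat_cpow (complex_of_real t) (P - mat 1) ** mat_cpow (complex_of_real (1 - t)) (Q - mat 1)"

lemma continuous_on_mat_cpow:
  assumes "continuous_on S f" "\<And>t. t \<in> S \<Longrightarrow> f t > 0"
  shows "continuous_on S (\<lambda>t. mat_cpow (complex_of_real (f t)) M)"
  unfolding mat_cpow_def
  by (intro continuous_on_mat_exp continuous_intros assms)
    (use assms(2) in \<open>auto simp: complex_nonpos_Reals_iff dest: leD\<close>)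

lemma continuous_on_euler_kernel:
  assumes "positive_stable B"
  shows "continuous_on {0<..<1} (euler_kernel A B Y P Q)"
  unfolding euler_kernel_def[abs_def]
  by (intro mat_mult.continuous_on continuous_on_hyp1F1_mat continuous_on_mat_cpow assms continuous_intros) auto

text \<open>The 1F1 factor is bounded uniformly in \<open>t\<close>, although its argument blows up
  at both endpoints, so the kernel is dominated by a multiple of a scalar beta density.\<close>

lemma set_integrable_euler_kernel:
  fixes A B Y P Q :: "complex^'r^'r"
  assumes "positive_stable A" "positive_stable B" "positive_stable Y" "positive_stable P" "positive_stable Q"
  shows "set_integrable lborel {0<..<1} (euler_kernel A B Y P Q)"
proof -
  from norm_matrix_mult_bound[where 'r='r] obtain K where K: "K > 0"
    "\<forall>(M :: complex^'r^'r) (N :: complex^'r^'r). norm (M ** N) \<le> K * norm M * norm N"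
    by (elim exE conjE)
  obtain H where H: "\<And>s. s \<ge> 0 \<Longrightarrow> norm (hyp1F1_mat A B (complex_of_real (- s) *\<^sub>m Y)) \<le> H"
    using hyp1F1_mat_bounded[OF assms(1-3)] by blast
  have H0: "H \<ge> 0" by (rule order_trans[OF norm_ge_zero H[of 0]]) simp
  from mat_cpow_bound[OF assms(4)] obtain C1 \<delta>1 where C1: "\<delta>1 > 0" "C1 \<ge> 0"
    "\<forall>t\<in>{0<..<1}. norm (mat_cpow (complex_of_real t) (P - mat 1)) \<le> C1 * t powr (\<delta>1 - 1)"
    by (elim exE conjE)
  from mat_cpow_bound[OF assms(5)] obtain C2 \<delta>2 where C2: "\<delta>2 > 0" "C2 \<ge> 0"
    "\<forall>t\<in>{0<..<1}. norm (mat_cpow (complex_of_real t) (Q - mat 1)) \<le> C2 * t powr (\<delta>2 - 1)"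
    by (elim exE conjE)
  define D where "D = K * K * H * C1 * C2"
  have "set_integrable lborel {0<..<1} (\<lambda>t. t powr (\<delta>1 - 1) * (1 - t) powr (\<delta>2 - 1))"
    by (rule set_integrable_subset[OF integrable_Beta[OF C1(1) C2(1)]]) auto
  then have "set_integrable lborel {0<..<1} (\<lambda>t. D * (t powr (\<delta>1 - 1) * (1 - t) powr (\<delta>2 - 1)))"
    by simp
  then show ?thesis
  proof (rule set_integrable_bound)
    show "set_borel_measurable lborel {0<..<1} (euler_kernel A B Y P Q)"
      unfolding set_borel_measurable_def
      using borel_measurable_continuous_on_indicator[OF _ continuous_on_euler_kernel[OF assms(2)]] by simp
    have "norm (euler_kernel A B Y P Q t) \<le> D * (t powr (\<delta>1 - 1) * (1 - t) powr (\<delta>2 - 1))"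
      if t: "t \<in> {0<..<1}" for t
    proof -
      define h p q where "h = hyp1F1_mat A B (complex_of_real (- (1 / (t * (1 - t)))) *\<^sub>m Y)"
        and "p = mat_cpow (complex_of_real t) (P - mat 1)"
        and "q = mat_cpow (complex_of_real (1 - t)) (Q - mat 1)"
      have h: "norm h \<le> H" unfolding h_def using t by (intro H) auto
      have pq: "norm p \<le> C1 * t powr (\<delta>1 - 1)" "norm q \<le> C2 * (1 - t) powr (\<delta>2 - 1)"
        using C1(3)[rule_format, of t] C2(3)[rule_format, of "1 - t"] t by (auto simp: p_def q_def)
      have "norm (h ** p ** q) \<le> K * norm (h ** p) * norm q" using K(2) by blast
      also have "\<dots> \<le> K * (K * norm h * norm p) * norm q"
        using K by (intro mult_right_mono mult_left_mono) auto
      also have "\<dots> \<le> K * (K * H * (C1 * t powr (\<delta>1 - 1))) * (C2 * (1 - t) powr (\<delta>2 - 1))"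
        using K(1) h H0 C1(2) C2(2) pq by (intro mult_mono) auto
      finally show ?thesis by (simp add: euler_kernel_def h_def p_def q_def D_def mult_ac)
    qed
    then show "AE t in lborel. t \<in> {0<..<1} \<longrightarrow> norm (euler_kernel A B Y P Q t)
        \<le> norm (D * (t powr (\<delta>1 - 1) * (1 - t) powr (\<delta>2 - 1)))"
      by (intro always_eventually) (fastforce intro: order_trans[OF _ abs_ge_self])
  qed
qed

lemma ext_Beta_mat_add_nat:
  "ext_Beta_mat A B Y (P + mat (of_nat n)) Q
    = (LBINT t:{0<..<1}. complex_of_real t ^ n *\<^sub>m euler_kernel A B Y P Q t)"
  unfolding ext_Beta_mat_def
  by (rule set_lebesgue_integral_cong) (auto simp: euler_kernel_def mat_cpow_add_nat)

text \<open>Since \<open>t ^ n \<le> 1\<close> on the interval, the terms are dominated by a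
  summable sequence times one integrable function, which permits exchanging sum and integral. The
  sum over \<open>n\<close> is the binomial series at \<open>z * t\<close>, acting from the
  left.\<close>

lemma ext_hyp2F1_mat_euler:
  fixes A B Y A1 B1 C1 :: "complex^'r^'r"
  assumes stable: "positive_stable A" "positive_stable B" "positive_stable Y"
    "positive_stable B1" "positive_stable (C1 - B1)"
    and z: "norm z < 1"
  shows "set_integrable lborel {0<..<1}
      (\<lambda>t. mat_cpow (1 - z * complex_of_real t) (- A1) ** euler_kernel A B Y B1 (C1 - B1) t)" (is ?int)
    and "ext_hyp2F1_mat A B Y A1 B1 C1 z =
      (LBINT t:{0<..<1}. mat_cpow (1 - z * complex_of_real t) (- A1) ** euler_kernel A B Y B1 (C1 - B1) t)
      ** matrix_inv (Beta_mat B1 (C1 - B1))" (is ?eq)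
proof -
  from norm_matrix_mult_bound[where 'r='r] obtain K where K: "K > 0"
    "\<forall>(M :: complex^'r^'r) (N :: complex^'r^'r). norm (M ** N) \<le> K * norm M * norm N"
    by (elim exE conjE)
  define c where "c n = (1 / fact n) *\<^sub>m mat_pochhammer A1 n" for n
  have conv: "mat_conv c 1" unfolding c_def by (rule mat_conv_pochhammer)
  \<comment> \<open>Extension by zero, so that the theorems for integrals over the whole line
    apply.\<close>
  define k where "k t = indicat_real {0<..<1} t *\<^sub>R euler_kernel A B Y B1 (C1 - B1) t" for t
  have k: "integrable lborel k"
    using set_integrable_euler_kernel[OF stable] unfolding k_def set_integrable_def .
  define e where "e n t = complex_of_real t ^ n *\<^sub>m k t" for n t
  have e_le: "norm (e n t) \<le> norm (k t)" for n t
  proof (cases "t \<in> {0<..<1}")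
    case True
    then have "t ^ n \<le> 1" by (intro power_le_one) auto
    then show ?thesis using True by (simp add: e_def norm_power mult_left_le_one_le)
  qed (simp add: e_def k_def)
  have e: "integrable lborel (e n)" for n
  proof (rule Bochner_Integration.integrable_bound[OF k])
    have [measurable]: "k \<in> borel_measurable lborel"
      by (rule borel_measurable_integrable[OF k])
    have "(\<lambda>t. (t ^ n) *\<^sub>R k t) \<in> borel_measurable lborel" by measurable
    then show "e n \<in> borel_measurable lborel"
      by (simp add: e_def[abs_def] flip: scale_mat_scaleR)
  qed (use e_le in auto)
  define f where "f n t = z ^ n *\<^sub>m (c n ** e n t)" for n t
  have lin: "bounded_linear (\<lambda>X. z ^ n *\<^sub>m (c n ** X))" for n
    by (rule bounded_linear_compose[OF mat_scale.bounded_linear_right mat_mult.bounded_linear_right])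
  have f: "integrable lborel (f n)" for n
    unfolding f_def by (rule integrable_bounded_linear[OF lin e])
  have f_int: "integral\<^sup>L lborel (f n) = z ^ n *\<^sub>m (c n ** integral\<^sup>L lborel (e n))" for n
    unfolding f_def by (rule integral_bounded_linear[OF lin e])
  have f_le: "norm (f n t) \<le> K * (norm (c n) * norm z ^ n) * norm (k t)" for n t
  proof -
    have "norm (f n t) \<le> norm z ^ n * (K * norm (c n) * norm (e n t))"
      using K(2) by (auto simp: f_def norm_power intro!: mult_left_mono)
    also have "\<dots> \<le> norm z ^ n * (K * norm (c n) * norm (k t))"
      using K(1) e_le by (intro mult_left_mono) auto
    finally show ?thesis by (simp add: mult_ac)
  qed
  have summ: "summable (\<lambda>n. K * (norm (c n) * norm z ^ n) * D)" for D
    by (intro summable_mult summable_mult2 mat_convD[OF conv] z) auto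
  have ae: "AE t in lborel. summable (\<lambda>n. norm (f n t))"
    by (intro always_eventually allI summable_comparison_test'[OF summ, of 0]) (use f_le in auto)
  have ints: "summable (\<lambda>n. \<integral>t. norm (f n t) \<partial>lborel)"
  proof (rule summable_comparison_test'[OF summ, of 0])
    fix n
    have "(\<integral>t. norm (f n t) \<partial>lborel) \<le> (\<integral>t. K * (norm (c n) * norm z ^ n) * norm (k t) \<partial>lborel)"
      using f k f_le by (intro integral_mono) auto
    then show "norm (\<integral>t. norm (f n t) \<partial>lborel) \<le> K * (norm (c n) * norm z ^ n) * (\<integral>t. norm (k t) \<partial>lborel)"
      by simp
  qed
  have suminf_f: "(\<Sum>n. f n t) = indicat_real {0<..<1} t *\<^sub>R
      (mat_cpow (1 - z * complex_of_real t) (- A1) ** euler_kernel A B Y B1 (C1 - B1) t)" for t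
  proof (cases "t \<in> {0<..<1}")
    case True
    have "norm (z * complex_of_real t) \<le> norm z * 1"
      using True unfolding norm_mult by (intro mult_left_mono) auto
    then have small: "norm (z * complex_of_real t) < 1" using z by linarith
    have "f n t = (z * complex_of_real t) ^ n *\<^sub>m (c n ** k t)" for n
      by (simp add: f_def e_def power_mult_distrib mult_ac)
    then have "(\<Sum>n. f n t) = mat_series (\<lambda>n. c n ** k t) (z * complex_of_real t)"
      by (simp add: mat_series_def)
    also have "\<dots> = mat_series c (z * complex_of_real t) ** k t"
      by (rule mat_series_mult_right[OF conv small])
    finally show ?thesis
      using True mat_binomial_series[OF small, of A1] by (simp add: k_def c_def[abs_def])
  qed (simp add: f_def e_def k_def)
  show ?int
    using integrable_suminf[OF f ae ints] unfolding set_integrable_def suminf_f .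
  have "integral\<^sup>L lborel (e n) = ext_Beta_mat A B Y (B1 + mat (of_nat n)) (C1 - B1)" for n
    unfolding ext_Beta_mat_add_nat set_lebesgue_integral_def e_def k_def
    by (simp add: mat_scale.scaleR_right)
  then have "(z ^ n / fact n) *\<^sub>m (mat_pochhammer A1 n ** ext_Beta_mat A B Y (B1 + mat (of_nat n)) (C1 - B1)
        ** matrix_inv (Beta_mat B1 (C1 - B1)))
      = integral\<^sup>L lborel (f n) ** matrix_inv (Beta_mat B1 (C1 - B1))" for n
    by (simp add: f_int c_def)
  then have "ext_hyp2F1_mat A B Y A1 B1 C1 z
      = (\<Sum>n. integral\<^sup>L lborel (f n) ** matrix_inv (Beta_mat B1 (C1 - B1)))"
    unfolding ext_hyp2F1_mat_def by simp
  also have "\<dots> = (\<Sum>n. integral\<^sup>L lborel (f n)) ** matrix_inv (Beta_mat B1 (C1 - B1))"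
    by (rule bounded_linear.suminf[OF mat_mult.bounded_linear_left summable_integral[OF f ae ints], symmetric])
  also have "(\<Sum>n. integral\<^sup>L lborel (f n)) = (\<integral>t. (\<Sum>n. f n t) \<partial>lborel)"
    by (rule integral_suminf[OF f ae ints, symmetric])
  finally show ?eq unfolding suminf_f set_lebesgue_integral_def .
qed

section \<open>The transformation formulas\<close>

lemma mat_cpow_commute:
  assumes "M ** N = N ** M"
  shows "mat_cpow s M ** mat_cpow t N = mat_cpow t N ** mat_cpow s M"
proof -
  have "(Ln s *\<^sub>m M) ** (Ln t *\<^sub>m N) = (Ln t *\<^sub>m N) ** (Ln s *\<^sub>m M)"
    using assms by (simp add: mult.commute)
  from mat_exp_commute[OF mat_exp_commute[OF this, symmetric]] show ?thesis
    by (simp add: mat_cpow_def)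
qed

lemma integral_matrix_commute:
  fixes f :: "'a \<Rightarrow> complex^'r^'r"
  assumes "\<And>x. f x ** N = N ** f x"
  shows "integral\<^sup>L M f ** N = N ** integral\<^sup>L M f"
proof (cases "integrable M f")
  case True
  have "integral\<^sup>L M f ** N = (\<integral>x. f x ** N \<partial>M)"
    by (rule integral_bounded_linear[OF mat_mult.bounded_linear_left True, symmetric])
  also have "\<dots> = N ** integral\<^sup>L M f"
    unfolding assms by (rule integral_bounded_linear[OF mat_mult.bounded_linear_right True])
  finally show ?thesis .
\<comment> \<open>A non-integrable function has integral 0, which commutes with every matrix; hence
  no convergence proof for the Gamma integrals is called for.\<close>
qed (simp add: not_integrable_integral_eq)

text \<open>Commutation is carried through the integrals one at a time: from the powers of
  \<open>t\<close> to one Gamma factor, then to both. The factor with \<open>P + Q\<close> is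
  symmetric.\<close>

lemma Beta_mat_commute:
  fixes P Q :: "complex^'r^'r"
  assumes "P ** Q = Q ** P"
  shows "Beta_mat P Q = Beta_mat Q P"
proof -
  have PQ: "(P - mat 1) ** (Q - mat 1) = (Q - mat 1) ** (P - mat 1)"
    using assms by (simp add: matrix_mul_distrib)
  have "Gamma_mat P ** mat_cpow (complex_of_real t) (Q - mat 1)
      = mat_cpow (complex_of_real t) (Q - mat 1) ** Gamma_mat P" for t
    unfolding Gamma_mat_def set_lebesgue_integral_def
    by (intro integral_matrix_commute)
      (simp add: mat_cpow_commute[OF PQ] mat_mult.scaleR_left mat_mult.scaleR_right)
  then have "Gamma_mat Q ** Gamma_mat P = Gamma_mat P ** Gamma_mat Q"
    unfolding Gamma_mat_def[of Q] set_lebesgue_integral_def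
    by (intro integral_matrix_commute) (simp add: mat_mult.scaleR_left mat_mult.scaleR_right)
  then show ?thesis by (simp add: Beta_mat_def add.commute)
qed

text \<open>The 1F1 argument depends only on \<open>t * (1 - t)\<close>, and the two matrix powers
  may be exchanged because their exponents commute.\<close>

lemma euler_kernel_reflect:
  assumes "P ** Q = Q ** P"
  shows "euler_kernel A B Y P Q (1 - t) = euler_kernel A B Y Q P t"
proof -
  have "(P - mat 1) ** (Q - mat 1) = (Q - mat 1) ** (P - mat 1)"
    using assms by (simp add: matrix_mul_distrib)
  from mat_cpow_commute[OF this, of "complex_of_real (1 - t)" "complex_of_real t"] show ?thesis
    by (simp add: euler_kernel_def mult.commute flip: matrix_mul_assoc)
qed

text \<open>Both arguments lie strictly between \<open>- pi / 2\<close> and \<open>pi / 2\<close>,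
  so their sum stays in the principal range and the logarithms add.\<close>

lemma mat_cpow_mult:
  assumes "Re x > 0" "Re y > 0"
  shows "mat_cpow (x * y) M = mat_cpow x M ** mat_cpow y M"
proof -
  have "\<bar>Im (Ln x)\<bar> < pi / 2" "\<bar>Im (Ln y)\<bar> < pi / 2"
    using assms Re_Ln_pos_lt_imp by blast+
  then have "Ln (x * y) = Ln y + Ln x"
    using assms by (subst Ln_times_simple) (auto simp: abs_less_iff)
  then show ?thesis by (simp add: mat_cpow_def mat_exp_add)
qed

lemma mat_cpow_inverse:
  assumes "Re x > 0"
  shows "mat_cpow (1 / x) (- M) = mat_cpow x M"
proof -
  have "x \<notin> \<real>\<^sub>\<le>\<^sub>0" using assms by (auto simp: complex_nonpos_Reals_iff)
  then show ?thesis by (simp add: mat_cpow_def Ln_inverse inverse_eq_divide[symmetric])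
qed

lemma ext_hyp2F1_mat_pfaff:
  fixes A B Y A1 B1 C1 :: "complex^'r^'r"
  assumes stable: "positive_stable A" "positive_stable B" "positive_stable Y"
    "positive_stable B1" "positive_stable (C1 - B1)"
    and comm: "B1 ** C1 = C1 ** B1"
    and z: "norm z < 1" "norm (z / (z - 1)) < 1"
  shows "ext_hyp2F1_mat A B Y A1 B1 C1 z =
    mat_cpow (1 - z) (- A1) ** ext_hyp2F1_mat A B Y A1 (C1 - B1) C1 (z / (z - 1))"
proof -
  define Q where "Q = C1 - B1"
  define w where "w = z / (z - 1)"
  have w: "norm w < 1" using z(2) by (simp add: w_def)
  have [simp]: "C1 - Q = B1" by (simp add: Q_def)
  have BQ: "B1 ** Q = Q ** B1" using comm by (simp add: Q_def matrix_mul_distrib)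
  have z1: "z \<noteq> 1" using z(1) by auto
  have Re_pos: "Re (1 - u) > 0" if "norm u < 1" for u :: complex
    using that complex_Re_le_cmod[of u] by simp
  define F where "F t = mat_cpow (1 - z * complex_of_real t) (- A1) ** euler_kernel A B Y B1 Q t" for t
  define G where "G t = mat_cpow (1 - w * complex_of_real t) (- A1) ** euler_kernel A B Y Q B1 t" for t
  have G: "set_integrable lborel {0<..<1} G"
    "ext_hyp2F1_mat A B Y A1 Q C1 w = (LBINT t:{0<..<1}. G t) ** matrix_inv (Beta_mat Q B1)"
    using ext_hyp2F1_mat_euler[of A B Y Q C1 w A1] stable w unfolding G_def by (simp_all add: Q_def)
  have F: "ext_hyp2F1_mat A B Y A1 B1 C1 z = (LBINT t:{0<..<1}. F t) ** matrix_inv (Beta_mat B1 Q)"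
    using ext_hyp2F1_mat_euler(2)[of A B Y B1 C1 z A1] stable z(1) unfolding F_def by (simp add: Q_def)
  have FG: "F (1 - t) = mat_cpow (1 - z) (- A1) ** G t" if t: "t \<in> {0<..<1}" for t
  proof -
    have "norm (w * complex_of_real t) \<le> norm w * 1"
      using t unfolding norm_mult by (intro mult_left_mono) auto
    then have "norm (w * complex_of_real t) < 1" using w by linarith
    \<comment> \<open>The algebraic core of the Pfaff transformation: reflection splits off the
      constant factor \<open>1 - z\<close>. Both factors have positive real part, so the principal
      powers multiply.\<close>
    moreover have "1 - z * complex_of_real (1 - t) = (1 - z) * (1 - w * complex_of_real t)"
      using z1 by (simp add: w_def field_simps)
    ultimately have "mat_cpow (1 - z * complex_of_real (1 - t)) (- A1)
        = mat_cpow (1 - z) (- A1) ** mat_cpow (1 - w * complex_of_real t) (- A1)"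
      by (metis mat_cpow_mult Re_pos z(1))
    then show ?thesis
      unfolding F_def G_def euler_kernel_reflect[OF BQ] by (simp add: matrix_mul_assoc)
  qed
  \<comment> \<open>The substitution \<open>t\<close> to \<open>1 - t\<close> has Jacobian of
    modulus 1 and preserves the interval, hence its indicator.\<close>
  have "(LBINT t:{0<..<1}. F t) = (\<integral>t. indicat_real {0<..<1} (1 - t) *\<^sub>R F (1 - t) \<partial>lborel)"
    unfolding set_lebesgue_integral_def
    using lborel_integral_real_affine[of "- 1" "\<lambda>t. indicat_real {0<..<1} t *\<^sub>R F t" 1] by simp
  also have "\<dots> = (\<integral>t. mat_cpow (1 - z) (- A1) ** (indicat_real {0<..<1} t *\<^sub>R G t) \<partial>lborel)"
    by (intro Bochner_Integration.integral_cong refl) (auto simp: indicator_def FG)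
  also have "\<dots> = mat_cpow (1 - z) (- A1) ** (LBINT t:{0<..<1}. G t)"
    using G(1) unfolding set_integrable_def set_lebesgue_integral_def
    by (rule integral_bounded_linear[OF mat_mult.bounded_linear_right])
  finally show ?thesis
    unfolding F Q_def[symmetric] w_def[symmetric] G(2) Beta_mat_commute[OF BQ]
    by (simp add: matrix_mul_assoc)
qed

theorem theorem4p5:
  fixes A B Y A1 B1 C1 :: "complex^'r^'r"
  assumes "positive_stable A" and "positive_stable B" and "positive_stable Y"
    and "positive_stable A1" and "positive_stable B1" and "positive_stable C1"
    and "positive_stable (C1 - B1)"
    and "B1 ** C1 = C1 ** B1"
  shows "(\<forall>z::complex. norm z < 1 \<and> norm (z / (z - 1)) < 1 \<longrightarrow>
            ext_hyp2F1_mat A B Y A1 B1 C1 z =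
              mat_cpow (1 - z) (- A1) ** ext_hyp2F1_mat A B Y A1 (C1 - B1) C1 (z / (z - 1)))
       \<and> (\<forall>z::complex. norm (1 - 1 / z) < 1 \<and> norm (1 - z) < 1 \<longrightarrow>
            ext_hyp2F1_mat A B Y A1 B1 C1 (1 - 1 / z) =
              mat_cpow z A1 ** ext_hyp2F1_mat A B Y A1 (C1 - B1) C1 (1 - z))
       \<and> (\<forall>z::complex. norm (z / (1 + z)) < 1 \<and> norm (- z) < 1 \<longrightarrow>
            ext_hyp2F1_mat A B Y A1 B1 C1 (z / (1 + z)) =
              mat_cpow (1 + z) A1 ** ext_hyp2F1_mat A B Y A1 (C1 - B1) C1 (- z))"
proof (intro conjI allI impI; elim conjE)
  \<comment> \<open>At an argument \<open>u\<close> the prefactor is the power \<open>- A1\<close>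
    of \<open>1 - u\<close>. For \<open>u = 1 - 1 / z\<close> and \<open>u = z / (1 + z)\<close>
    that base is a reciprocal, and \<open>mat_cpow_inverse\<close> turns it over.\<close>
  note pfaff = ext_hyp2F1_mat_pfaff[OF assms(1-3) assms(5) assms(7,8), of _ A1]
  show "ext_hyp2F1_mat A B Y A1 B1 C1 z =
      mat_cpow (1 - z) (- A1) ** ext_hyp2F1_mat A B Y A1 (C1 - B1) C1 (z / (z - 1))"
    if "norm z < 1" "norm (z / (z - 1)) < 1" for z
    using that by (rule pfaff)
  show "ext_hyp2F1_mat A B Y A1 B1 C1 (1 - 1 / z) =
      mat_cpow z A1 ** ext_hyp2F1_mat A B Y A1 (C1 - B1) C1 (1 - z)"
    if "norm (1 - 1 / z) < 1" "norm (1 - z) < 1" for z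
  proof -
    \<comment> \<open>The point \<open>z = 0\<close>, where \<open>1 / z\<close> takes the default
      value 0, violates the second bound.\<close>
    have "z \<noteq> 0" using that(2) by auto
    then have "(1 - 1 / z) / ((1 - 1 / z) - 1) = 1 - z" by (simp add: field_simps)
    moreover have "Re z > 0" using that(2) complex_Re_le_cmod[of "1 - z"] by simp
    ultimately show ?thesis
      using pfaff[of "1 - 1 / z"] that mat_cpow_inverse[of z A1] by simp
  qed
  show "ext_hyp2F1_mat A B Y A1 B1 C1 (z / (1 + z)) =
      mat_cpow (1 + z) A1 ** ext_hyp2F1_mat A B Y A1 (C1 - B1) C1 (- z)"
    if "norm (z / (1 + z)) < 1" "norm (- z) < 1" for z
  proof -
    have Re: "Re (1 + z) > 0" using that(2) complex_Re_le_cmod[of "- z"] by simp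
    then have "1 + z \<noteq> 0" by (metis less_irrefl zero_complex.sel(1))
    then have "z / (1 + z) / (z / (1 + z) - 1) = - z" "1 - z / (1 + z) = 1 / (1 + z)"
      by (simp_all add: field_simps)
    then show ?thesis
      using pfaff[of "z / (1 + z)"] that mat_cpow_inverse[OF Re, of A1] by simp
  qed
qed

end
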